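(* Let $B$ be a skew brace with property (S) and let $n$ be a positive integer. If $B/\operatorname{Ann}_n(B)$ is finite, then $B$ has a finite ideal $I$ such that $B/I$ is annihilator nilpotent of length $n$.
   Context: A skew (left) brace is a triple $(B,+,\circ)$ where $(B,+)$ and $(B,\circ)$ are (not necessarily abelian) groups such that $a\circ(b+c)=a\circ b-a+a\circ c$ for all $a,b,c\in B$. The two identities coincide and are denoted $0$. Put $\lambda_a(b)=-a+a\circ b$ and $a\ast b=\lambda_a(b)-b=-a+a\circ b-b$; $\lambda:(B,\circ)\to\operatorname{Aut}(B,+)$, $a\mapsto\lambda_a$, is a group homomorphism. For $x\in B$ let $\operatorname{Fix}^r(x)=\{b\in B: x\ast b=0\}$ (a subgroup of $(B,+)$), $\operatorname{Fix}^l(x)=\{b\in B: b\ast x=0\}$ (a subgroup of $(B,\circ)$), and let $C_x^+$, $C_x^\circ$ be the centralisers of $x$ in $(B,+)$ and $(B,\circ)$. An element $x$ has property (s) if the indices $|(B,+):\operatorname{Fix}^r(x)\cap C_x^+|$ and $|(B,\circ):\operatorname{Fix}^l(x)\cap C_x^\circ|$ are both finite. $B$ has property (S) if all its elements have property (s). An ideal of $B$ is a subset $I$ that is a normal subgroup of both $(B,+)$ and $(B,\circ)$ and satisfies $\lambda_a(I)\subseteq I$ for all $a\in B$; then $B/I$ is a skew brace. The annihilator is the ideal $\operatorname{Ann}(B)=\operatorname{Ker}(\lambda)\cap Z(B,+)\cap Z(B,\circ)$. Put $\operatorname{Ann}_0(B)=\{0\}$ and $\operatorname{Ann}_{k+1}(B)/\operatorname{Ann}_k(B)=\operatorname{Ann}(B/\operatorname{Ann}_k(B))$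 for integers $k\ge 0$. A skew brace $C$ is annihilator nilpotent of length $n$ if $C=\operatorname{Ann}_n(C)$. *)

theory Defs
  imports "HOL-Algebra.AbelCoset"
begin

text \<open>
  A skew brace is carried by a record of type \<open>ring\<close>, used only as a carrier with two operations:
  \<open>\<oplus>\<close> is the (not necessarily abelian) addition and \<open>\<otimes>\<close> is the circle operation.
  The equality of the two identities follows from the axioms (\<open>skew_brace.one_eq_zero\<close> below).
\<close>

locale skew_brace =
  fixes B (structure)
  assumes add_group: "group (add_monoid B)"
    and circ_group: "group B"
    and brace_eq: "\<lbrakk>a \<in> carrier B; b \<in> carrier B; c \<in> carrier B\<rbrakk>
      \<Longrightarrow> a \<otimes> (b \<oplus> c) = ((a \<otimes> b) \<ominus> a) \<oplus> (a \<otimes> c)"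

lemma (in skew_brace) one_eq_zero: "\<one> = \<zero>"
proof -
  interpret A: group "add_monoid B" by (rule add_group)
  interpret M: group B by (rule circ_group)
  have z: "\<zero> \<in> carrier B" using A.one_closed by simp
  have m: "\<ominus> \<one> \<in> carrier B" using A.inv_closed[of \<one>] by (simp add: a_inv_def)
  have "\<zero> = (\<zero> \<ominus> \<one>) \<oplus> \<zero>"
    using brace_eq[OF M.one_closed z z] z A.l_one[of \<zero>] by simp
  then have "\<zero> = \<ominus> \<one>"
    using A.l_one[of "\<ominus> \<one>"] A.r_one[of "\<ominus> \<one>"] m by (simp add: a_minus_def)
  then show ?thesis
    using A.r_inv[of \<one>] A.r_one[of \<one>] by (simp add: a_inv_def)
qed

definition brace_lambda :: "('a, 'm) ring_scheme \<Rightarrow> 'a \<Rightarrow> 'a \<Rightarrow> 'a"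
  where "brace_lambda B a b = \<ominus>\<^bsub>B\<^esub> a \<oplus>\<^bsub>B\<^esub> (a \<otimes>\<^bsub>B\<^esub> b)"

definition brace_star :: "('a, 'm) ring_scheme \<Rightarrow> 'a \<Rightarrow> 'a \<Rightarrow> 'a"
  where "brace_star B a b = brace_lambda B a b \<ominus>\<^bsub>B\<^esub> b"

definition group_centralizer :: "('a, 'm) monoid_scheme \<Rightarrow> 'a \<Rightarrow> 'a set"
  where "group_centralizer G x = {y \<in> carrier G. y \<otimes>\<^bsub>G\<^esub> x = x \<otimes>\<^bsub>G\<^esub> y}"

definition group_center :: "('a, 'm) monoid_scheme \<Rightarrow> 'a set"
  where "group_center G = {x \<in> carrier G. \<forall>y \<in> carrier G. x \<otimes>\<^bsub>G\<^esub> y = y \<otimes>\<^bsub>G\<^esub> x}"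

definition Fix_r :: "('a, 'm) ring_scheme \<Rightarrow> 'a \<Rightarrow> 'a set"
  where "Fix_r B x = {b \<in> carrier B. brace_star B x b = \<zero>\<^bsub>B\<^esub>}"

definition Fix_l :: "('a, 'm) ring_scheme \<Rightarrow> 'a \<Rightarrow> 'a set"
  where "Fix_l B x = {b \<in> carrier B. brace_star B b x = \<zero>\<^bsub>B\<^esub>}"

definition property_s :: "('a, 'm) ring_scheme \<Rightarrow> 'a \<Rightarrow> bool"
  where "property_s B x \<longleftrightarrow>
    finite (rcosets\<^bsub>add_monoid B\<^esub> (Fix_r B x \<inter> group_centralizer (add_monoid B) x)) \<and>
    finite (rcosets\<^bsub>B\<^esub> (Fix_l B x \<inter> group_centralizer B x))"

definition property_S :: "('a, 'm) ring_scheme \<Rightarrow> bool"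
  where "property_S B \<longleftrightarrow> (\<forall>x \<in> carrier B. property_s B x)"

definition brace_ideal :: "'a set \<Rightarrow> ('a, 'm) ring_scheme \<Rightarrow> bool"
  where "brace_ideal I B \<longleftrightarrow>
    I \<lhd> add_monoid B \<and> I \<lhd> B \<and> (\<forall>a \<in> carrier B. brace_lambda B a ` I \<subseteq> I)"

text \<open>
  For an ideal \<open>I\<close> the additive and multiplicative cosets of an element coincide (lemma
  \<open>brace_ideal_cosets\<close>), so both operations of \<open>B/I\<close> are the elementwise products of cosets;
  the additive group of \<open>B/I\<close> is \<open>add_monoid B Mod I\<close> and its circle group is \<open>B Mod I\<close>.
\<close>

definition brace_quot :: "('a, 'm) ring_scheme \<Rightarrow> 'a set \<Rightarrow> 'a set ring"
  where "brace_quot B I =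
    \<lparr>carrier = a_rcosets\<^bsub>B\<^esub> I, mult = set_mult B, one = I, zero = I, add = set_add B\<rparr>"

text \<open>The kernel of \<open>\<lambda>\<close> consists of the \<open>a\<close> for which \<open>\<lambda>\<^sub>a\<close> is the identity on the carrier.\<close>

definition brace_Ann :: "('a, 'm) ring_scheme \<Rightarrow> 'a set"
  where "brace_Ann B =
    {a \<in> carrier B. \<forall>b \<in> carrier B. brace_lambda B a b = b} \<inter>
    group_center (add_monoid B) \<inter> group_center B"

text \<open>\<open>Ann\<^sub>k\<^sub>+\<^sub>1(B)\<close> is the preimage of \<open>Ann(B/Ann\<^sub>k(B))\<close> under the projection \<open>B \<rightarrow> B/Ann\<^sub>k(B)\<close>.\<close>

primrec brace_Ann_series :: "('a, 'm) ring_scheme \<Rightarrow> nat \<Rightarrow> 'a set"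
  where
    "brace_Ann_series B 0 = {\<zero>\<^bsub>B\<^esub>}"
  | "brace_Ann_series B (Suc k) =
      {x \<in> carrier B. brace_Ann_series B k +>\<^bsub>B\<^esub> x
        \<in> brace_Ann (brace_quot B (brace_Ann_series B k))}"

definition annihilator_nilpotent :: "('a, 'm) ring_scheme \<Rightarrow> nat \<Rightarrow> bool"
  where "annihilator_nilpotent C n \<longleftrightarrow> carrier C = brace_Ann_series C n"

lemma (in skew_brace) brace_ideal_cosets:
  assumes I: "brace_ideal I B" and a: "a \<in> carrier B"
  shows "I +> a = I #> a"
proof -
  interpret A: group "add_monoid B" by (rule add_group)
  interpret M: group B by (rule circ_group)
  interpret NA: normal I "add_monoid B" using I by (simp add: brace_ideal_def)
  interpret NM: normal I B using I by (simp add: brace_ideal_def)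
  have lam: "\<And>x i. x \<in> carrier B \<Longrightarrow> i \<in> I \<Longrightarrow> brace_lambda B x i \<in> I"
    using I by (auto simp: brace_ideal_def)
  have circ: "x \<otimes> y = x \<oplus> brace_lambda B x y" if "x \<in> carrier B" "y \<in> carrier B" for x y
    using that A.inv_closed[of x] A.m_assoc[of x "\<ominus> x" "x \<otimes> y"] A.r_inv[of x] A.l_one[of "x \<otimes> y"]
    by (simp add: brace_lambda_def a_inv_def)
  have A_eq: "I +> a = a <+ I"
    using NA.coset_eq a by (simp add: a_r_coset_def a_l_coset_def)
  have M_eq: "I #> a = a <# I" using NM.coset_eq a by blast
  have "a <# I \<subseteq> a <+ I"
    using lam[OF a] circ[OF a] NM.mem_carrier by (auto simp: l_coset_def a_l_coset_def)
  moreover have "a <+ I \<subseteq> a <# I"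
  proof
    fix y assume "y \<in> a <+ I"
    then obtain i where i: "i \<in> I" "y = a \<oplus> i" by (auto simp: l_coset_def a_l_coset_def)
    define j where "j = inv a \<otimes> (a \<oplus> i)"
    have ic: "i \<in> carrier B" using i NM.mem_carrier by blast
    have inva: "inv a \<in> carrier B" using a by simp
    have ai: "a \<oplus> i \<in> carrier B" using A.m_closed[of a i] a ic by simp
    have "j = (\<one> \<ominus> inv a) \<oplus> (inv a \<otimes> i)"
      using brace_eq[OF inva a ic] a by (simp add: j_def)
    also have "\<dots> = brace_lambda B (inv a) i"
      using one_eq_zero A.l_one[of "\<ominus> (inv a)"] A.inv_closed[of "inv a"] inva
      by (simp add: brace_lambda_def a_minus_def a_inv_def)
    finally have "j \<in> I" using lam[OF inva] i by simp
    moreover have "y = a \<otimes> j"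
      using a ai i by (simp add: j_def M.m_assoc[symmetric])
    ultimately show "y \<in> a <# I" by (auto simp: l_coset_def)
  qed
  ultimately show ?thesis using A_eq M_eq by blast
qed

end

theory Submission
  imports Defs "HOL-Algebra.Generated_Groups"
begin

text \<open>
  The theorem is an analogue of Baer's theorem that a group which is finite modulo the \<open>n\<close>-th term
  of its upper central series has a finite \<open>(n+1)\<close>-st term of the lower central series, and the
  proof descends along the annihilator series in the same way. Starting from \<open>J = B\<close>, which is
  finite modulo \<open>Ann\<^sub>n(B)\<close>, one replaces an ideal \<open>J\<close> that is finite modulo \<open>Ann\<^sub>m\<^sub>+\<^sub>1(B)\<close> by an ideal
  that is finite modulo \<open>Ann\<^sub>m(B)\<close> and modulo which \<open>J\<close> is central (\<open>central_chain_step\<close>). After \<open>n\<close>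
  steps the ideal is finite, and the chain of ideals obtained on the way shows that the quotient by
  it is annihilator nilpotent of length \<open>n\<close> (\<open>annihilator_nilpotent_of_central_chain\<close>).

  A single step takes place in \<open>B/Ann\<^sub>m(B)\<close> and amounts to the case where \<open>J\<close> is finite modulo \<open>Z = Ann(B)\<close>
  (locale \<open>ideal_finite_mod_Ann\<close>). The new ideal is the additive subgroup generated by all
  commutators of \<open>J\<close> with \<open>B\<close>: the elements \<open>-f + \<phi>(f)\<close> for \<open>f\<close> in \<open>J\<close> and \<open>\<phi>\<close> a composite of maps
  \<open>\<lambda>\<^sub>a\<close> and inner automorphisms of \<open>(B, +)\<close>, and the conjugates of the elements \<open>-b + \<lambda>\<^sub>f(b)\<close>. Both
  kinds depend on \<open>f\<close> only modulo \<open>Z\<close>, so there are finitely many \<open>f\<close> to consider, and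
  property (S) says that each of them contributes finitely many elements
  (\<open>finite_orbits_of_property_S\<close>).

  It remains to see that these finitely many elements generate a finite group. They form a set that
  is closed under conjugation, so it is enough that some multiple \<open>k x\<close> of each generator \<open>x\<close> is a sum
  of fewer than \<open>k\<close> generators (\<open>finite_generate_of_shortening\<close>). For the first kind this is the
  computation in Schur's theorem (\<open>twist_commutators_shortening\<close>). For the second kind, a circle
  power of \<open>f\<close> lies in \<open>Z\<close> and so acts trivially, while \<open>f \<mapsto> -b + \<lambda>\<^sub>f(b)\<close> turns circle powers of \<open>f\<close>
  into multiples up to the finite group generated by the first kind; hence these generators have
  finite order (\<open>displacement_torsion\<close>).
\<close>

section \<open>Finiteness of groups generated by finite normal sets\<close>

context group
begin

primrec list_prod :: "'a list \<Rightarrow> 'a"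
  where
    "list_prod [] = \<one>"
  | "list_prod (x # xs) = x \<otimes> list_prod xs"

lemma list_prod_closed [simp]: "set xs \<subseteq> carrier G \<Longrightarrow> list_prod xs \<in> carrier G"
  by (induction xs) auto

lemma list_prod_append:
  "set xs \<subseteq> carrier G \<Longrightarrow> set ys \<subseteq> carrier G
    \<Longrightarrow> list_prod (xs @ ys) = list_prod xs \<otimes> list_prod ys"
  by (induction xs) (auto simp: m_assoc)

lemma list_prod_replicate:
  assumes "x \<in> carrier G"
  shows "list_prod (replicate k x) = x [^] k"
proof (induction k)
  case (Suc k)
  then show ?case using nat_pow_Suc2[OF assms, of k] by simp
qed simp

text \<open>
  By the pigeonhole principle two powers \<open>x\<^sup>i\<close>, \<open>x\<^sup>j\<close> with \<open>i < j\<close> lie in one coset, and then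
  \<open>x\<^sup>j\<^sup>-\<^sup>i\<close> lies in \<open>H\<close>.
\<close>

lemma pow_mem_of_finite_cosets:
  assumes H: "subgroup H G" and x: "x \<in> carrier G"
    and fin: "finite (range (\<lambda>k::nat. H #> x [^] k))"
  obtains k :: nat where "k > 0" "x [^] k \<in> H"
proof -
  have "\<not> inj (\<lambda>k::nat. H #> x [^] k)"
    using fin finite_imageD infinite_UNIV_nat by blast
  then obtain i j :: nat where ij: "i < j" "H #> x [^] i = H #> x [^] j"
    by (auto simp: inj_def) (metis linorder_neqE_nat)
  have "x [^] j \<in> H #> x [^] i"
    using repr_independenceD[OF H _ ij(2)] x by simp
  then obtain h where h: "h \<in> H" "x [^] j = h \<otimes> x [^] i" by (auto simp: r_coset_def)
  have hc: "h \<in> carrier G" using h(1) subgroup.mem_carrier[OF H] by blast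
  have "x [^] (j - i) \<otimes> x [^] i = h \<otimes> x [^] i"
    using ij(1) h(2) x by (simp add: nat_pow_mult)
  then have "x [^] (j - i) = h" using x hc by simp
  then show thesis using that[of "j - i"] ij(1) h(1) by simp
qed

lemma pow_eq_one_of_finite_subgroup:
  assumes H: "subgroup H G" "finite H" and x: "x \<in> H"
  obtains k :: nat where "k > 0" "x [^] k = \<one>"
proof -
  have xc: "x \<in> carrier G" using subgroup.mem_carrier[OF H(1) x] .
  have "x [^] k \<in> H" for k :: nat
    using x by (induction k) (auto intro: subgroup.m_closed[OF H(1)] subgroup.one_closed[OF H(1)])
  then have "finite (range (\<lambda>k::nat. {\<one>} #> x [^] k))"
    by (intro finite_subset[OF _ finite_imageI[OF H(2), of "\<lambda>y. {\<one>} #> y"]]) auto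
  from pow_mem_of_finite_cosets[OF triv_subgroup xc this] that show thesis by blast
qed

text \<open>
  The occurrences of \<open>x\<close> in a product can be moved to the front, at the price of conjugating the
  factors that they pass by powers of \<open>x\<close>.
\<close>

lemma list_prod_collect:
  assumes X: "X \<subseteq> carrier G" and conj: "\<And>x y. x \<in> X \<Longrightarrow> y \<in> X \<Longrightarrow> inv x \<otimes> y \<otimes> x \<in> X"
    and x: "x \<in> X" and xs: "set xs \<subseteq> X"
  shows "\<exists>ys. set ys \<subseteq> X \<and> length ys + count_list xs x = length xs
    \<and> list_prod xs = x [^] count_list xs x \<otimes> list_prod ys"
  using xs
proof (induction xs)
  case Nil
  then show ?case by (auto intro: exI[of _ "[]"])
next
  case (Cons y xs)
  then obtain ys where ys: "set ys \<subseteq> X" "length ys + count_list xs x = length xs"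
    "list_prod xs = x [^] count_list xs x \<otimes> list_prod ys" by auto
  have xc: "x \<in> carrier G" and yX: "y \<in> X" and yc: "y \<in> carrier G"
    using x X Cons.prems by auto
  have pc: "list_prod ys \<in> carrier G" using ys(1) X by simp
  define k where "k = count_list xs x"
  show ?case
  proof (cases "y = x")
    case True
    have "list_prod (y # xs) = x [^] Suc k \<otimes> list_prod ys"
      using True ys(3) xc pc nat_pow_Suc2[OF xc, of k] by (simp add: k_def m_assoc[symmetric])
    then show ?thesis using True ys by (intro exI[of _ ys]) (simp add: k_def)
  next
    case False
    have conj_pow: "inv (x [^] j) \<otimes> y \<otimes> x [^] j \<in> X" for j :: nat
    proof (induction j)
      case 0
      then show ?case using yX yc by simp
    next
      case (Suc j)
      have "inv (x [^] Suc j) \<otimes> y \<otimes> x [^] Suc j = inv x \<otimes> (inv (x [^] j) \<otimes> y \<otimes> x [^] j) \<otimes> x"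
        using xc yc by (simp add: inv_mult_group m_assoc)
      then show ?case using conj[OF x Suc] by simp
    qed
    define z where "z = inv (x [^] k) \<otimes> y \<otimes> x [^] k"
    have zX: "z \<in> X" and zc: "z \<in> carrier G" using conj_pow X by (auto simp: z_def)
    have "x [^] k \<otimes> z = y \<otimes> x [^] k"
      using xc yc by (simp add: z_def m_assoc[symmetric])
    then have "list_prod (y # xs) = x [^] k \<otimes> list_prod (z # ys)"
      using ys(3) xc yc zc pc by (simp add: k_def m_assoc[symmetric])
    then show ?thesis using False ys zX by (intro exI[of _ "z # ys"]) (simp add: k_def)
  qed
qed

text \<open>
  A common refinement of Dietzmann's lemma (where \<open>x\<^sup>k = \<one>\<close>) and of the last step of Schur's
  theorem on groups that are finite modulo their centre. In a long product some \<open>x\<close> occurs at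
  least \<open>k\<close> times; once these occurrences are collected, the hypothesis replaces \<open>k\<close> of them by
  fewer factors. So every product of elements of \<open>X\<close> equals one of bounded length.
\<close>

lemma finite_generate_of_shortening:
  assumes X: "X \<subseteq> carrier G" and fin: "finite X"
    and conj: "\<And>x y. x \<in> X \<Longrightarrow> y \<in> X \<Longrightarrow> inv x \<otimes> y \<otimes> x \<in> X"
    and short: "\<And>x. x \<in> X \<Longrightarrow> \<exists>k ys. set ys \<subseteq> X \<and> length ys < k \<and> x [^] (k::nat) = list_prod ys"
  shows "finite (generate G X)"
proof -
  from short obtain k w where kw:
    "\<And>x. x \<in> X \<Longrightarrow> set (w x) \<subseteq> X \<and> length (w x) < k x \<and> x [^] (k x :: nat) = list_prod (w x)"
    by metis
  define N where "N = sum k X"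
  define L where "L = {xs. set xs \<subseteq> X \<and> length xs \<le> N}"
  define P where "P = list_prod ` {xs. set xs \<subseteq> X}"
  have shorten: "list_prod xs \<in> list_prod ` L" if "set xs \<subseteq> X" for xs
    using that
  proof (induction "length xs" arbitrary: xs rule: less_induct)
    case less
    show ?case
    proof (cases "length xs \<le> N")
      case True
      then show ?thesis using less.prems by (auto simp: L_def)
    next
      case False
      have "\<exists>x\<in>X. k x \<le> count_list xs x"
      proof (rule ccontr)
        assume "\<not> ?thesis"
        then have "sum (count_list xs) X \<le> sum k X" by (intro sum_mono) (auto simp: not_le less_imp_le)
        then show False using False sum_count_set[OF less.prems fin] by (simp add: N_def)
      qed
      then obtain x where x: "x \<in> X" "k x \<le> count_list xs x" by blast
      obtain ys where ys: "set ys \<subseteq> X" "length ys + count_list xs x = length xs"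
        "list_prod xs = x [^] count_list xs x \<otimes> list_prod ys"
        using list_prod_collect[OF X conj x(1) less.prems] by auto
      define c where "c = count_list xs x - k x"
      have xc: "x \<in> carrier G" using x(1) X by blast
      have wx: "set (w x) \<subseteq> carrier G" using kw[OF x(1)] X by blast
      have yc: "set ys \<subseteq> carrier G" using ys(1) X by blast
      have rc: "set (replicate c x) \<subseteq> carrier G" using xc by (auto simp: set_replicate_conv_if)
      let ?zs = "w x @ replicate c x @ ys"
      have "x [^] count_list xs x = x [^] k x \<otimes> x [^] c"
        using x(2) xc by (simp add: c_def nat_pow_mult)
      also have "\<dots> = list_prod (w x) \<otimes> list_prod (replicate c x)"
        using kw[OF x(1)] list_prod_replicate[OF xc] by simp
      finally have "list_prod xs = list_prod ?zs"
        using ys(3) list_prod_append wx yc rc by (simp add: m_assoc)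
      moreover have "length ?zs < length xs"
        using ys(2) x(2) kw[OF x(1)] unfolding c_def length_append length_replicate by linarith
      moreover have "set ?zs \<subseteq> X" using kw[OF x(1)] x(1) ys(1) by (auto simp: set_replicate_conv_if)
      ultimately show ?thesis using less.hyps by metis
    qed
  qed
  have "finite L" using finite_lists_length_le[OF fin] by (simp add: L_def)
  then have finP: "finite P" using shorten by (auto simp: P_def intro: finite_subset)
  have Pc: "P \<subseteq> carrier G" using X by (auto simp: P_def)
  have P_mult: "a \<otimes> b \<in> P" if "a \<in> P" "b \<in> P" for a b
  proof -
    from that obtain xs ys where "set xs \<subseteq> X" "a = list_prod xs" "set ys \<subseteq> X" "b = list_prod ys"
      by (auto simp: P_def)
    then show ?thesis using list_prod_append[of xs ys] X
      by (auto simp: P_def intro!: image_eqI[of _ _ "xs @ ys"])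
  qed
  have P_one: "\<one> \<in> P" by (auto simp: P_def intro: image_eqI[of _ _ "[]"])
  have P_pow: "a [^] j \<in> P" if "a \<in> P" for a and j :: nat
    using that by (induction j) (auto intro: P_one P_mult)
  \<comment> \<open>A finite submonoid of a group is closed under inverses.\<close>
  have P_inv: "inv a \<in> P" if a: "a \<in> P" for a
  proof -
    have ac: "a \<in> carrier G" using a Pc by blast
    have "finite (range (\<lambda>j::nat. {\<one>} #> a [^] j))"
      using P_pow[OF a]
      by (intro finite_subset[OF _ finite_imageI[OF finP, of "\<lambda>y. {\<one>} #> y"]]) auto
    from pow_mem_of_finite_cosets[OF triv_subgroup ac this]
    obtain j :: nat where j: "j > 0" "a [^] j = \<one>" by blast
    then have "a [^] (j - 1) \<otimes> a = \<one>" using ac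
      by (metis Suc_diff_1 nat_pow_Suc)
    then have "inv a = a [^] (j - 1)" using ac by (intro inv_equality) auto
    then show ?thesis using P_pow[OF a] by simp
  qed
  have XP: "x \<in> P" if "x \<in> X" for x
    using that X by (auto simp: P_def intro!: image_eqI[of _ _ "[x]"])
  have "generate G X \<subseteq> P"
  proof
    fix a assume "a \<in> generate G X"
    then show "a \<in> P" by induction (auto intro: P_one XP P_inv P_mult)
  qed
  then show ?thesis using finP finite_subset by blast
qed

lemma hom_generate_subset:
  assumes X: "X \<subseteq> carrier G" and f: "\<phi> \<in> hom G G" and H: "subgroup H G"
    and img: "\<phi> ` X \<subseteq> H"
  shows "\<phi> ` generate G X \<subseteq> H"
proof -
  interpret \<phi>: group_hom G G \<phi> using f by unfold_locales
  show ?thesis using \<phi>.generate_img[OF X] generate_subgroup_incl[OF img H] by simp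
qed

end


section \<open>Calculus in a skew brace\<close>

context skew_brace
begin

text \<open>
  The addition is not commutative, so the locale of abelian groups does not apply; the group facts
  for it are restated in additive notation here.
\<close>

sublocale add: group "add_monoid B"
  rewrites "carrier (add_monoid B) = carrier B"
    and "mult (add_monoid B) = add B"
    and "one (add_monoid B) = zero B"
    and "m_inv (add_monoid B) = a_inv B"
    and "r_coset (add_monoid B) = a_r_coset B"
    and "(\<lambda>a k. pow (add_monoid B) a k) = (\<lambda>a k. add_pow B k a)"
  by (rule add_group) (auto simp: a_inv_def a_r_coset_def add_pow_def)

sublocale circ: group B by (rule circ_group)

declare one_eq_zero [simp]

abbreviation lam :: "'a \<Rightarrow> 'a \<Rightarrow> 'a" where "lam \<equiv> brace_lambda B"

lemma zero_circ [simp]: "a \<in> carrier B \<Longrightarrow> \<zero> \<otimes> a = a" "a \<in> carrier B \<Longrightarrow> a \<otimes> \<zero> = a"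
  using circ.l_one circ.r_one by simp_all

lemma circ_inv_zero [simp]:
  "a \<in> carrier B \<Longrightarrow> inv a \<otimes> a = \<zero>" "a \<in> carrier B \<Longrightarrow> a \<otimes> inv a = \<zero>"
  using circ.l_inv circ.r_inv by simp_all

lemma minus_add_cancel [simp]:
  assumes "a \<in> carrier B" "b \<in> carrier B"
  shows "\<ominus> a \<oplus> (a \<oplus> b) = b" "a \<oplus> (\<ominus> a \<oplus> b) = b"
  using assms by (simp_all add: add.m_assoc[symmetric])

lemma circ_cancel_left [simp]:
  assumes "a \<in> carrier B" "b \<in> carrier B"
  shows "inv a \<otimes> (a \<otimes> b) = b" "a \<otimes> (inv a \<otimes> b) = b"
  using assms by (simp_all add: circ.m_assoc[symmetric])

lemma lam_closed [simp]: "a \<in> carrier B \<Longrightarrow> b \<in> carrier B \<Longrightarrow> lam a b \<in> carrier B"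
  by (simp add: brace_lambda_def)

lemma circ_eq: "a \<in> carrier B \<Longrightarrow> b \<in> carrier B \<Longrightarrow> a \<otimes> b = a \<oplus> lam a b"
  by (simp add: brace_lambda_def)

lemma lam_add [simp]:
  assumes "a \<in> carrier B" "b \<in> carrier B" "c \<in> carrier B"
  shows "lam a (b \<oplus> c) = lam a b \<oplus> lam a c"
  using assms by (simp add: brace_lambda_def brace_eq a_minus_def add.m_assoc)

lemma lam_circ [simp]:
  assumes "a \<in> carrier B" "b \<in> carrier B" "c \<in> carrier B"
  shows "lam (a \<otimes> b) c = lam a (lam b c)"
proof -
  have "a \<oplus> (lam a b \<oplus> lam (a \<otimes> b) c) = a \<otimes> b \<otimes> c"
    using assms circ_eq[of "a \<otimes> b" c] circ_eq[of a b] by (simp add: add.m_assoc)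
  also have "\<dots> = a \<otimes> (b \<oplus> lam b c)"
    using assms by (simp add: circ.m_assoc circ_eq[of b])
  also have "\<dots> = a \<oplus> (lam a b \<oplus> lam a (lam b c))"
    using assms by (simp add: circ_eq[of a])
  finally show ?thesis using assms by simp
qed

lemma lam_of_zero [simp]: "b \<in> carrier B \<Longrightarrow> lam \<zero> b = b"
  by (simp add: brace_lambda_def add.inv_one del: one_eq_zero)

lemma lam_zero [simp]: "a \<in> carrier B \<Longrightarrow> lam a \<zero> = \<zero>"
  by (simp add: brace_lambda_def)

lemma lam_minus [simp]:
  assumes "a \<in> carrier B" "b \<in> carrier B"
  shows "lam a (\<ominus> b) = \<ominus> lam a b"
proof -
  have "lam a (\<ominus> b) \<oplus> lam a b = \<zero>"
    using assms lam_add[of a "\<ominus> b" b] by simp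
  then show ?thesis using assms by (simp add: add.inv_equality)
qed

lemma lam_inv_cancel [simp]:
  assumes "a \<in> carrier B" "b \<in> carrier B"
  shows "lam (inv a) (lam a b) = b" "lam a (lam (inv a) b) = b"
  using assms lam_circ[of "inv a" a b] lam_circ[of a "inv a" b] by simp_all

lemma circ_inv_eq: "a \<in> carrier B \<Longrightarrow> inv a = \<ominus> lam (inv a) a"
  using circ_eq[of "inv a" a] add.inv_equality[of "inv a" "lam (inv a) a"] by simp

text \<open>
  The maps \<open>x \<mapsto> d + \<lambda>\<^sub>a(x) - d\<close> form the group of automorphisms of \<open>(B, +)\<close> generated by the
  inner automorphisms and the \<open>\<lambda>\<^sub>a\<close>. A subgroup of \<open>(B, +)\<close> that they preserve is a normal
  \<open>\<lambda>\<close>-invariant subgroup (a strong left ideal).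
\<close>

definition twist :: "'a \<Rightarrow> 'a \<Rightarrow> 'a \<Rightarrow> 'a"
  where "twist d a x = d \<oplus> lam a x \<oplus> \<ominus> d"

lemma twist_closed [simp]:
  "d \<in> carrier B \<Longrightarrow> a \<in> carrier B \<Longrightarrow> x \<in> carrier B \<Longrightarrow> twist d a x \<in> carrier B"
  by (simp add: twist_def)

lemma twist_add:
  "d \<in> carrier B \<Longrightarrow> a \<in> carrier B \<Longrightarrow> x \<in> carrier B \<Longrightarrow> y \<in> carrier B
    \<Longrightarrow> twist d a (x \<oplus> y) = twist d a x \<oplus> twist d a y"
  by (simp add: twist_def add.m_assoc)

lemma twist_minus:
  "d \<in> carrier B \<Longrightarrow> a \<in> carrier B \<Longrightarrow> x \<in> carrier B \<Longrightarrow> twist d a (\<ominus> x) = \<ominus> twist d a x"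
  by (simp add: twist_def add.m_assoc add.inv_mult_group)

lemma twist_comp:
  "d \<in> carrier B \<Longrightarrow> a \<in> carrier B \<Longrightarrow> e \<in> carrier B \<Longrightarrow> b \<in> carrier B \<Longrightarrow> x \<in> carrier B
    \<Longrightarrow> twist d a (twist e b x) = twist (d \<oplus> lam a e) (a \<otimes> b) x"
  by (simp add: twist_def add.m_assoc add.inv_mult_group)

lemma twist_conj: "d \<in> carrier B \<Longrightarrow> x \<in> carrier B \<Longrightarrow> twist d \<zero> x = d \<oplus> x \<oplus> \<ominus> d"
  by (simp add: twist_def)

lemma twist_lam: "a \<in> carrier B \<Longrightarrow> x \<in> carrier B \<Longrightarrow> twist \<zero> a x = lam a x"
  by (simp add: twist_def)

lemma twist_inverse:
  assumes "d \<in> carrier B" "a \<in> carrier B" "x \<in> carrier B"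
  shows "twist (\<ominus> lam (inv a) d) (inv a) (twist d a x) = x"
  using assms by (simp add: twist_def add.m_assoc add.inv_mult_group)

lemma twist_hom:
  "d \<in> carrier B \<Longrightarrow> a \<in> carrier B \<Longrightarrow> twist d a \<in> hom (add_monoid B) (add_monoid B)"
  by (auto simp: hom_def twist_add)


subsection \<open>Ideals\<close>

text \<open>
  That \<open>I\<close> is a subgroup of the circle group follows from its invariance under \<open>\<lambda>\<close>, by the
  identities \<open>x \<circ> y = x + \<lambda>\<^sub>x(y)\<close> and \<open>x\<^sup>-\<^sup>1 = -\<lambda>\<^sub>y(x)\<close> with \<open>y = x\<^sup>-\<^sup>1\<close>.
\<close>

lemma brace_idealI:
  assumes sub: "I \<subseteq> carrier B" and zero: "\<zero> \<in> I"
    and add: "\<And>x y. x \<in> I \<Longrightarrow> y \<in> I \<Longrightarrow> x \<oplus> y \<in> I"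
    and minus: "\<And>x. x \<in> I \<Longrightarrow> \<ominus> x \<in> I"
    and twist: "\<And>d a x. d \<in> carrier B \<Longrightarrow> a \<in> carrier B \<Longrightarrow> x \<in> I \<Longrightarrow> twist d a x \<in> I"
    and circ_conj: "\<And>a x. a \<in> carrier B \<Longrightarrow> x \<in> I \<Longrightarrow> a \<otimes> x \<otimes> inv a \<in> I"
  shows "brace_ideal I B"
proof -
  have lam: "lam a x \<in> I" if "a \<in> carrier B" "x \<in> I" for a x
    using twist[of \<zero> a x] that sub by (auto simp: twist_lam)
  have conj: "d \<oplus> x \<oplus> \<ominus> d \<in> I" if "d \<in> carrier B" "x \<in> I" for d x
    using twist[of d \<zero> x] that sub by (auto simp: twist_conj)
  have "subgroup I (add_monoid B)"
    using sub zero add minus by (intro subgroup.intro) (auto simp: a_inv_def)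
  then have "I \<lhd> add_monoid B"
    using conj by (simp add: group.normal_inv_iff[OF add_group] a_inv_def)
  moreover have "subgroup I B"
  proof (intro subgroup.intro)
    fix x y assume xy: "x \<in> I" "y \<in> I"
    then have c: "x \<in> carrier B" "y \<in> carrier B" using sub by blast+
    show "x \<otimes> y \<in> I" unfolding circ_eq[OF c] using xy c by (intro add lam)
  next
    fix x assume "x \<in> I"
    moreover from this have "x \<in> carrier B" using sub by blast
    ultimately show "inv x \<in> I" using circ_inv_eq[of x] minus[OF lam[of "inv x" x]] by simp
  qed (use sub zero in auto)
  then have "I \<lhd> B" using circ_conj by (simp add: circ.normal_inv_iff)
  ultimately show ?thesis using lam by (auto simp: brace_ideal_def)
qed

lemma brace_idealD:
  assumes "brace_ideal I B"
  shows "I \<subseteq> carrier B" "\<zero> \<in> I"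
    and "\<And>x y. x \<in> I \<Longrightarrow> y \<in> I \<Longrightarrow> x \<oplus> y \<in> I"
    and "\<And>x. x \<in> I \<Longrightarrow> \<ominus> x \<in> I"
    and "\<And>a x. a \<in> carrier B \<Longrightarrow> x \<in> I \<Longrightarrow> lam a x \<in> I"
    and "\<And>d x. d \<in> carrier B \<Longrightarrow> x \<in> I \<Longrightarrow> d \<oplus> x \<oplus> \<ominus> d \<in> I"
    and "\<And>d a x. d \<in> carrier B \<Longrightarrow> a \<in> carrier B \<Longrightarrow> x \<in> I \<Longrightarrow> twist d a x \<in> I"
    and "\<And>a x. a \<in> carrier B \<Longrightarrow> x \<in> I \<Longrightarrow> a \<otimes> x \<otimes> inv a \<in> I"
    and "\<And>x y. x \<in> I \<Longrightarrow> y \<in> I \<Longrightarrow> x \<otimes> y \<in> I"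
    and "subgroup I (add_monoid B)" "subgroup I B" "I \<lhd> add_monoid B" "I \<lhd> B"
proof -
  show NA: "I \<lhd> add_monoid B" and NB: "I \<lhd> B" using assms by (auto simp: brace_ideal_def)
  show SA: "subgroup I (add_monoid B)" and SB: "subgroup I B"
    using NA NB normal_imp_subgroup by auto
  show sub: "I \<subseteq> carrier B" using subgroup.subset[OF SB] .
  show "\<zero> \<in> I" using subgroup.one_closed[OF SA] by simp
  show "x \<oplus> y \<in> I" if "x \<in> I" "y \<in> I" for x y using subgroup.m_closed[OF SA that] by simp
  show "\<ominus> x \<in> I" if "x \<in> I" for x
    using subgroup.m_inv_closed[OF SA that] by (simp add: a_inv_def)
  show lam: "lam a x \<in> I" if "a \<in> carrier B" "x \<in> I" for a x
    using assms that by (auto simp: brace_ideal_def)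
  show conj: "d \<oplus> x \<oplus> \<ominus> d \<in> I" if "d \<in> carrier B" "x \<in> I" for d x
    using NA that by (simp add: group.normal_inv_iff[OF add_group] a_inv_def)
  show "twist d a x \<in> I" if "d \<in> carrier B" "a \<in> carrier B" "x \<in> I" for d a x
    using conj[OF that(1) lam[OF that(2,3)]] by (simp add: twist_def)
  show "a \<otimes> x \<otimes> inv a \<in> I" if "a \<in> carrier B" "x \<in> I" for a x
    using NB that by (simp add: circ.normal_inv_iff)
  show "x \<otimes> y \<in> I" if "x \<in> I" "y \<in> I" for x y using subgroup.m_closed[OF SB that] by simp
qed

lemma a_rcos_eq_iff:
  assumes "subgroup H (add_monoid B)" "x \<in> carrier B" "y \<in> carrier B"
  shows "H +> x = H +> y \<longleftrightarrow> x \<oplus> \<ominus> y \<in> H"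
proof
  assume "H +> x = H +> y"
  then have "x \<in> H +> y" using add.rcos_self[OF assms(2,1)] by simp
  then obtain h where "h \<in> H" "x = h \<oplus> y" by (auto simp: a_r_coset_def r_coset_def)
  moreover have "h \<in> carrier B" using \<open>h \<in> H\<close> subgroup.subset[OF assms(1)] by auto
  ultimately show "x \<oplus> \<ominus> y \<in> H" using assms by (simp add: add.m_assoc)
next
  assume h: "x \<oplus> \<ominus> y \<in> H"
  have "x = (x \<oplus> \<ominus> y) \<oplus> y" using assms by (simp add: add.m_assoc)
  then have "x \<in> H +> y" using h unfolding a_r_coset_def r_coset_def by auto
  then show "H +> x = H +> y" using add.repr_independence[OF _ assms(3,1)] by simp
qed

text \<open>
  An element of \<open>Ann(B)\<close> combines with any other element in one and the same way under both
  operations and in either order; in this form the condition can be compared with congruences.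
\<close>

lemma mem_brace_Ann_iff:
  "z \<in> brace_Ann B \<longleftrightarrow> z \<in> carrier B \<and>
    (\<forall>b\<in>carrier B. z \<oplus> b = b \<oplus> z \<and> z \<otimes> b = z \<oplus> b \<and> b \<otimes> z = z \<oplus> b)"
proof -
  have "lam z b = b \<longleftrightarrow> z \<otimes> b = z \<oplus> b" if "z \<in> carrier B" "b \<in> carrier B" for b
    using that by (simp add: circ_eq)
  moreover have "z \<in> brace_Ann B \<longleftrightarrow> z \<in> carrier B \<and>
      (\<forall>b\<in>carrier B. z \<oplus> b = b \<oplus> z \<and> lam z b = b \<and> z \<otimes> b = b \<otimes> z)"
    unfolding brace_Ann_def group_center_def partial_object.simps monoid.simps by blast
  ultimately show ?thesis by metis
qed

lemma brace_Ann_lam: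
  assumes "z \<in> brace_Ann B" "b \<in> carrier B"
  shows "lam z b = b" "lam b z = z" "z \<oplus> b = b \<oplus> z" "b \<otimes> z = z \<otimes> b"
proof -
  have z: "z \<in> carrier B" "z \<oplus> b = b \<oplus> z" "z \<otimes> b = z \<oplus> b" "b \<otimes> z = z \<oplus> b"
    using assms unfolding mem_brace_Ann_iff by blast+
  then show "z \<oplus> b = b \<oplus> z" "b \<otimes> z = z \<otimes> b" by metis+
  show "lam z b = b" unfolding brace_lambda_def z(3) using z(1) assms(2) by simp
  show "lam b z = z" unfolding brace_lambda_def z(4) z(2) using z(1) assms(2) by simp
qed

lemma twist_Ann:
  assumes "z \<in> brace_Ann B" "d \<in> carrier B" "a \<in> carrier B"
  shows "twist d a z = z"
proof -
  have z: "z \<in> carrier B" using assms(1) unfolding mem_brace_Ann_iff by blast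
  have "twist d a z = z \<oplus> d \<oplus> \<ominus> d"
    using assms by (simp add: twist_def brace_Ann_lam)
  then show ?thesis using z assms(2) by (simp add: add.m_assoc)
qed

lemma brace_ideal_Ann: "brace_ideal (brace_Ann B) B"
proof (rule brace_idealI)
  show sub: "brace_Ann B \<subseteq> carrier B" by (auto simp: mem_brace_Ann_iff)
  show "\<zero> \<in> brace_Ann B" by (auto simp: mem_brace_Ann_iff)
  show "twist d a x \<in> brace_Ann B" if "d \<in> carrier B" "a \<in> carrier B" "x \<in> brace_Ann B" for d a x
    using that by (simp add: twist_Ann)
  show "a \<otimes> x \<otimes> inv a \<in> brace_Ann B" if "a \<in> carrier B" "x \<in> brace_Ann B" for a x
  proof -
    have "a \<otimes> x \<otimes> inv a = x" using that sub brace_Ann_lam(4)[of x a]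
      by (auto simp: circ.m_assoc)
    then show ?thesis using that by simp
  qed
  show add: "x \<oplus> y \<in> brace_Ann B" if x: "x \<in> brace_Ann B" and y: "y \<in> brace_Ann B" for x y
    unfolding mem_brace_Ann_iff
  proof (intro conjI ballI)
    have c: "x \<in> carrier B" "y \<in> carrier B" using x y sub by auto
    then show "x \<oplus> y \<in> carrier B" by simp
    have xy: "x \<oplus> y = x \<otimes> y" using x c(2) unfolding mem_brace_Ann_iff by metis
    fix b assume b: "b \<in> carrier B"
    have "x \<oplus> y \<oplus> b = x \<oplus> (b \<oplus> y)"
      unfolding brace_Ann_lam(3)[OF y b, symmetric] using c b by (simp add: add.m_assoc)
    also have "\<dots> = b \<oplus> x \<oplus> y"
      unfolding brace_Ann_lam(3)[OF x b, symmetric] using c b by (simp add: add.m_assoc)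
    finally show *: "x \<oplus> y \<oplus> b = b \<oplus> (x \<oplus> y)" using c b by (simp add: add.m_assoc)
    show "(x \<oplus> y) \<otimes> b = x \<oplus> y \<oplus> b"
      using c b brace_Ann_lam(1)[OF x b] brace_Ann_lam(1)[OF y b] circ_eq[of "x \<otimes> y" b]
      unfolding xy by simp
    show "b \<otimes> (x \<oplus> y) = x \<oplus> y \<oplus> b"
      using c b brace_Ann_lam(2)[OF x b] brace_Ann_lam(2)[OF y b] circ_eq[of b "x \<oplus> y"]
      unfolding * by simp
  qed
  show "\<ominus> x \<in> brace_Ann B" if x: "x \<in> brace_Ann B" for x
    unfolding mem_brace_Ann_iff
  proof (intro conjI ballI)
    have c: "x \<in> carrier B" using x sub by auto
    then show "\<ominus> x \<in> carrier B" by simp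
    have inv: "\<ominus> x = inv x"
    proof -
      have "x \<otimes> \<ominus> x = \<zero>" using c brace_Ann_lam(1)[OF x, of "\<ominus> x"] by (simp add: circ_eq)
      then have "inv x \<otimes> (x \<otimes> \<ominus> x) = inv x" using c by simp
      then show ?thesis using c by simp
    qed
    fix b assume b: "b \<in> carrier B"
    have "\<ominus> x \<oplus> (x \<oplus> b) \<oplus> \<ominus> x = \<ominus> x \<oplus> (b \<oplus> x) \<oplus> \<ominus> x"
      unfolding brace_Ann_lam(3)[OF x b] ..
    then have "b \<oplus> \<ominus> x = \<ominus> x \<oplus> b" using c b by (simp add: add.m_assoc)
    then show *: "\<ominus> x \<oplus> b = b \<oplus> \<ominus> x" by (rule sym)
    have "lam (inv x) b = lam (inv x) (lam x b)" using brace_Ann_lam(1)[OF x b] by simp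
    then have "lam (\<ominus> x) b = b" using c b by (simp add: inv)
    then show "\<ominus> x \<otimes> b = \<ominus> x \<oplus> b" using c b by (simp add: circ_eq)
    show "b \<otimes> \<ominus> x = \<ominus> x \<oplus> b"
      using c b brace_Ann_lam(2)[OF x b] circ_eq[of b "\<ominus> x"] unfolding * by simp
  qed
qed

end


section \<open>Orbits in skew braces with property (S)\<close>

text \<open>
  This is the form in which property (S) is used. A condition on the size of orbits passes to
  quotients simply by taking images, whereas for indices of stabilisers one would have to compare
  subgroups of \<open>B\<close> with subgroups of the quotient.
\<close>

definition finite_orbits :: "('a, 'm) ring_scheme \<Rightarrow> bool"
  where "finite_orbits B \<longleftrightarrow> (\<forall>x\<in>carrier B.
    finite ((\<lambda>d. d \<oplus>\<^bsub>B\<^esub> x \<oplus>\<^bsub>B\<^esub> \<ominus>\<^bsub>B\<^esub> d) ` carrier B) \<and>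
    finite ((\<lambda>a. brace_lambda B a x) ` carrier B) \<and>
    finite ((\<lambda>b. \<ominus>\<^bsub>B\<^esub> b \<oplus>\<^bsub>B\<^esub> brace_lambda B x b) ` carrier B))"

lemma finite_image_of_factor:
  assumes "finite (f ` A)" and "\<And>x y. x \<in> A \<Longrightarrow> y \<in> A \<Longrightarrow> f x = f y \<Longrightarrow> g x = g y"
  shows "finite (g ` A)"
proof -
  have "g x = g (SOME y. y \<in> A \<and> f y = f x)" if x: "x \<in> A" for x
  proof -
    let ?y = "SOME y. y \<in> A \<and> f y = f x"
    have "?y \<in> A \<and> f ?y = f x" using x by (intro someI_ex[of "\<lambda>y. y \<in> A \<and> f y = f x"]) blast
    then show ?thesis using assms(2)[OF x, of ?y] by simp
  qed
  then have "g ` A \<subseteq> (\<lambda>c. g (SOME y. y \<in> A \<and> f y = c)) ` f ` A" by blast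
  then show ?thesis using assms(1) finite_subset by blast
qed

lemma (in group) finite_image_of_coset_invariant:
  assumes fin: "finite (rcosets H)" and one: "\<one> \<in> H"
    and inv: "\<And>a b. a \<in> H \<Longrightarrow> b \<in> carrier G \<Longrightarrow> g (a \<otimes> b) = g b"
  shows "finite (g ` carrier G)"
proof (rule finite_image_of_factor)
  show "finite ((\<lambda>b. H #> b) ` carrier G)"
    by (rule finite_subset[OF _ fin]) (auto simp: RCOSETS_def)
  fix x y assume xy: "x \<in> carrier G" "y \<in> carrier G" "H #> x = H #> y"
  have "\<one> \<otimes> x \<in> H #> x" using one unfolding r_coset_def by blast
  then obtain a where "a \<in> H" "x = a \<otimes> y" using xy by (auto simp: r_coset_def)
  then show "g x = g y" using inv xy(2) by simp
qed

text \<open>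
  Each of the three orbit maps is constant on the right cosets of a stabiliser that contains one of
  the two intersections in property (S), after the parameter has been replaced by its inverse in the
  case of conjugation and of \<open>a \<mapsto> \<lambda>\<^sub>a(x)\<close>.
\<close>

lemma (in skew_brace) finite_orbits_of_property_S:
  assumes S: "property_S B"
  shows "finite_orbits B"
  unfolding finite_orbits_def
proof (intro ballI conjI)
  fix x assume x: "x \<in> carrier B"
  let ?H = "Fix_r B x \<inter> group_centralizer (add_monoid B) x"
  let ?K = "Fix_l B x \<inter> group_centralizer B x"
  have finH: "finite (rcosets\<^bsub>add_monoid B\<^esub> ?H)" and finK: "finite (rcosets ?K)"
    using S x by (auto simp: property_S_def property_s_def)
  have star: "brace_star B a b = \<zero> \<longleftrightarrow> lam a b = b" if "a \<in> carrier B" "b \<in> carrier B" for a b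
    using that by (simp add: brace_star_def a_minus_def)
      (metis add.inv_closed add.inv_equality add.inv_inv add.r_inv lam_closed)
  have H: "h \<in> carrier B" "lam x h = h" "h \<oplus> x = x \<oplus> h" if "h \<in> ?H" for h
    using that star[OF x] by (auto simp: Fix_r_def group_centralizer_def)
  have K: "k \<in> carrier B" "lam k x = x" if "k \<in> ?K" for k
    using that star[OF _ x] by (auto simp: Fix_l_def group_centralizer_def)
  have zH: "\<zero> \<in> ?H" using x star by (auto simp: Fix_r_def group_centralizer_def)
  have zK: "\<zero> \<in> ?K" using x star by (auto simp: Fix_l_def group_centralizer_def)
  have "finite ((\<lambda>d. \<ominus> d \<oplus> x \<oplus> d) ` carrier B)"
  proof (rule group.finite_image_of_coset_invariant[OF add_group finH, simplified])
    show "\<zero> \<in> Fix_r B x \<and> \<zero> \<in> group_centralizer (add_monoid B) x" using zH by blast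
    fix h d assume h: "h \<in> Fix_r B x \<and> h \<in> group_centralizer (add_monoid B) x"
      and d: "d \<in> carrier B"
    have hc: "h \<in> carrier B" and com: "h \<oplus> x = x \<oplus> h" using H h by blast+
    have "\<ominus> (h \<oplus> d) \<oplus> x \<oplus> (h \<oplus> d) = \<ominus> d \<oplus> \<ominus> h \<oplus> (x \<oplus> h) \<oplus> d"
      using hc x d by (simp add: add.m_assoc add.inv_mult_group)
    also have "\<dots> = \<ominus> d \<oplus> x \<oplus> d"
      unfolding com[symmetric] using hc x d by (simp add: add.m_assoc)
    finally show "\<ominus> (h \<oplus> d) \<oplus> x \<oplus> (h \<oplus> d) = \<ominus> d \<oplus> x \<oplus> d" .
  qed
  moreover have "d \<oplus> x \<oplus> \<ominus> d \<in> (\<lambda>d. \<ominus> d \<oplus> x \<oplus> d) ` carrier B" if "d \<in> carrier B" for d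
    using that by (intro image_eqI[of _ _ "\<ominus> d"]) auto
  ultimately show "finite ((\<lambda>d. d \<oplus> x \<oplus> \<ominus> d) ` carrier B)"
    by (elim finite_subset[rotated]) blast
  show "finite ((\<lambda>b. \<ominus> b \<oplus> lam x b) ` carrier B)"
  proof (rule group.finite_image_of_coset_invariant[OF add_group finH, simplified])
    show "\<zero> \<in> Fix_r B x \<and> \<zero> \<in> group_centralizer (add_monoid B) x" using zH by blast
    fix h b assume h: "h \<in> Fix_r B x \<and> h \<in> group_centralizer (add_monoid B) x"
      and b: "b \<in> carrier B"
    have hc: "h \<in> carrier B" and lam_h: "lam x h = h" using H h by blast+
    show "\<ominus> (h \<oplus> b) \<oplus> lam x (h \<oplus> b) = \<ominus> b \<oplus> lam x b"
      using hc x b by (simp add: lam_h add.m_assoc add.inv_mult_group)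
  qed
  have "finite ((\<lambda>a. lam (inv a) x) ` carrier B)"
  proof (rule circ.finite_image_of_coset_invariant[OF finK])
    show "\<one> \<in> ?K" using zK by simp
    fix k a assume k: "k \<in> ?K" and a: "a \<in> carrier B"
    have kc: "k \<in> carrier B" and kx: "lam k x = x" using K[OF k] by blast+
    have "lam (inv k) x = lam (inv k) (lam k x)" unfolding kx ..
    then have "lam (inv k) x = x" using kc x by simp
    then show "lam (inv (k \<otimes> a)) x = lam (inv a) x"
      using kc a x by (simp add: circ.inv_mult_group)
  qed
  moreover have "lam a x \<in> (\<lambda>a. lam (inv a) x) ` carrier B" if "a \<in> carrier B" for a
    using that by (intro image_eqI[of _ _ "inv a"]) auto
  ultimately show "finite ((\<lambda>a. lam a x) ` carrier B)"
    by (elim finite_subset[rotated]) blast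
qed


section \<open>Ideals that are finite modulo the annihilator\<close>

text \<open>
  The condition says that \<open>W + x\<close> lies in \<open>Ann(B/W)\<close>. It is phrased by congruences in \<open>B\<close> itself so
  that it can be carried between \<open>B\<close> and its quotients without forming cosets of cosets.
\<close>

definition central_mod :: "('a, 'm) ring_scheme \<Rightarrow> 'a set \<Rightarrow> 'a \<Rightarrow> bool"
  where "central_mod B W x \<longleftrightarrow> (\<forall>b\<in>carrier B.
    W +>\<^bsub>B\<^esub> (x \<oplus>\<^bsub>B\<^esub> b) = W +>\<^bsub>B\<^esub> (b \<oplus>\<^bsub>B\<^esub> x) \<and>
    W +>\<^bsub>B\<^esub> (x \<otimes>\<^bsub>B\<^esub> b) = W +>\<^bsub>B\<^esub> (x \<oplus>\<^bsub>B\<^esub> b) \<and>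
    W +>\<^bsub>B\<^esub> (b \<otimes>\<^bsub>B\<^esub> x) = W +>\<^bsub>B\<^esub> (x \<oplus>\<^bsub>B\<^esub> b))"

text \<open>
  The aim in this locale is a finite ideal \<open>I\<close> inside \<open>J\<close> such that \<open>J\<close> becomes central modulo \<open>I\<close> in
  the sense above: a counterpart of Schur's theorem, with \<open>I\<close> as the commutator of \<open>J\<close> and \<open>B\<close>.
\<close>

locale ideal_finite_mod_Ann = skew_brace +
  fixes J
  assumes J: "brace_ideal J B"
    and finite_cosets: "finite ((\<lambda>x. brace_Ann B +> x) ` J)"
    and orbits: "finite_orbits B"
begin

lemmas JD = brace_idealD[OF J]
lemmas AnnD = brace_idealD[OF brace_ideal_Ann]

lemma J_carrier [simp]: "x \<in> J \<Longrightarrow> x \<in> carrier B"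
  using JD(1) by blast

lemma representatives:
  obtains F where "finite F" "F \<subseteq> J" "\<And>x. x \<in> J \<Longrightarrow> \<exists>z\<in>brace_Ann B. \<exists>f\<in>F. x = z \<oplus> f"
proof -
  let ?q = "\<lambda>x. brace_Ann B +> x"
  obtain F where F: "F \<subseteq> J" "finite F" "?q ` J = ?q ` F"
    using finite_subset_image[OF finite_cosets, of ?q J] by auto
  show thesis
  proof (rule that[OF F(2,1)])
    fix x assume x: "x \<in> J"
    then obtain f where f: "f \<in> F" "?q x = ?q f" using F(3) by blast
    then have "x \<oplus> \<ominus> f \<in> brace_Ann B"
      using a_rcos_eq_iff[OF AnnD(10), of x f] x F(1) by auto
    moreover have "x = (x \<oplus> \<ominus> f) \<oplus> f" using x f(1) F(1) by (auto simp: add.m_assoc)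
    ultimately show "\<exists>z\<in>brace_Ann B. \<exists>f\<in>F. x = z \<oplus> f" using f(1) by blast
  qed
qed

lemma multiple_in_Ann:
  assumes c: "c \<in> J"
  obtains m :: nat where "m > 0" "[m] \<cdot> c \<in> brace_Ann B"
proof -
  have mult: "[k] \<cdot> c \<in> J" for k :: nat
    using c by (induction k) (auto intro: JD)
  have "finite (range (\<lambda>k::nat. brace_Ann B +> [k] \<cdot> c))"
    by (rule finite_subset[OF _ finite_cosets]) (use mult in auto)
  from add.pow_mem_of_finite_cosets[OF AnnD(10) _ this] c that show thesis by auto
qed

lemma circ_power_in_Ann:
  assumes f: "f \<in> J"
  obtains k :: nat where "k > 0" "f [^] k \<in> brace_Ann B"
proof -
  have pow: "f [^] k \<in> J" for k :: nat
    using f by (induction k) (auto intro: JD)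
  then have eq: "brace_Ann B #> f [^] k = brace_Ann B +> f [^] k" for k :: nat
    using brace_ideal_cosets[OF brace_ideal_Ann] by simp
  have "finite (range (\<lambda>k::nat. brace_Ann B #> f [^] k))"
    unfolding eq by (rule finite_subset[OF _ finite_cosets]) (use pow in auto)
  from circ.pow_mem_of_finite_cosets[OF AnnD(11) _ this] f that show thesis by auto
qed

text \<open>
  A twist is some \<open>\<lambda>\<^sub>a\<close> followed by an inner automorphism of \<open>(B, +)\<close>, so these elements comprise
  the additive commutators of \<open>f\<close> with \<open>B\<close> as well as the elements \<open>-f + \<lambda>\<^sub>a(f)\<close>, which are
  conjugate to \<open>a \<ast> f\<close>. Treating both at once makes the set invariant under all twists.
\<close>

definition twist_commutators :: "'a set"
  where "twist_commutators = {\<ominus> f \<oplus> twist d a f | f d a. f \<in> J \<and> d \<in> carrier B \<and> a \<in> carrier B}"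

lemma twist_commutatorsI:
  "f \<in> J \<Longrightarrow> d \<in> carrier B \<Longrightarrow> a \<in> carrier B \<Longrightarrow> \<ominus> f \<oplus> twist d a f \<in> twist_commutators"
  by (auto simp: twist_commutators_def)

lemma twist_commutators_subset: "twist_commutators \<subseteq> J"
  by (auto simp: twist_commutators_def intro!: JD(3,4,7))

lemma finite_twist_orbit:
  assumes x: "x \<in> carrier B"
  shows "finite {twist d a x | d a. d \<in> carrier B \<and> a \<in> carrier B}"
proof -
  let ?L = "(\<lambda>a. lam a x) ` carrier B"
  have "finite (\<Union>y\<in>?L. (\<lambda>d. d \<oplus> y \<oplus> \<ominus> d) ` carrier B)"
  proof (rule finite_UN_I)
    show "finite ?L" using orbits x unfolding finite_orbits_def by blast
    show "finite ((\<lambda>d. d \<oplus> y \<oplus> \<ominus> d) ` carrier B)" if "y \<in> ?L" for y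
      using orbits x that lam_closed unfolding finite_orbits_def by blast
  qed
  then show ?thesis by (rule rev_finite_subset) (auto simp: twist_def)
qed

text \<open>
  Twists fix the annihilator pointwise, so \<open>-f + \<phi>(f)\<close> depends only on the coset of \<open>f\<close> modulo the
  annihilator and on the orbit point \<open>\<phi>(f)\<close>.
\<close>

lemma finite_twist_commutators: "finite twist_commutators"
proof -
  obtain F where F: "finite F" "F \<subseteq> J"
    "\<And>x. x \<in> J \<Longrightarrow> \<exists>z\<in>brace_Ann B. \<exists>f\<in>F. x = z \<oplus> f" using representatives by blast
  let ?S = "\<Union>f\<in>F. (\<lambda>y. \<ominus> f \<oplus> y) ` {twist d a f | d a. d \<in> carrier B \<and> a \<in> carrier B}"
  have "twist_commutators \<subseteq> ?S"
  proof
    fix c assume "c \<in> twist_commutators"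
    then obtain x d a where x: "x \<in> J" and da: "d \<in> carrier B" "a \<in> carrier B"
      and c: "c = \<ominus> x \<oplus> twist d a x" by (auto simp: twist_commutators_def)
    obtain z f where zf: "z \<in> brace_Ann B" "f \<in> F" "x = z \<oplus> f" using F(3)[OF x] by blast
    have zc: "z \<in> carrier B" and fc: "f \<in> carrier B" using zf AnnD(1) F(2) by auto
    have "c = \<ominus> f \<oplus> twist d a f"
      using da zc fc zf(1) by (simp add: c zf(3) twist_add twist_Ann add.inv_mult_group add.m_assoc)
    then show "c \<in> ?S" using zf(2) da by blast
  qed
  moreover have "finite ?S" using F finite_twist_orbit by auto
  ultimately show ?thesis using finite_subset by blast
qed

text \<open>
  For twists \<open>\<psi>\<close> and \<open>\<phi>\<close>, and \<open>g = \<psi>(f)\<close>, one has \<open>\<psi>(-f + \<phi>(f)) = -g + (\<psi>\<phi>\<psi>\<^sup>-\<^sup>1)(g)\<close>; the parameters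
  \<open>u\<close>, \<open>v\<close> below are those of the twist \<open>\<psi>\<phi>\<psi>\<^sup>-\<^sup>1\<close>.
\<close>

lemma twist_twist_commutators:
  assumes c: "c \<in> twist_commutators" and da: "d \<in> carrier B" "a \<in> carrier B"
  shows "twist d a c \<in> twist_commutators"
proof -
  obtain f e b where f: "f \<in> J" and eb: "e \<in> carrier B" "b \<in> carrier B"
    and c: "c = \<ominus> f \<oplus> twist e b f" using c by (auto simp: twist_commutators_def)
  define g where "g = twist d a f"
  define d' where "d' = \<ominus> lam (inv a) d"
  have d'c: "d' \<in> carrier B" using da by (simp add: d'_def)
  have gJ: "g \<in> J" using JD(7) da f by (simp add: g_def)
  have f_eq: "f = twist d' (inv a) g"
    using twist_inverse[OF da, of f] f by (simp add: g_def d'_def)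
  define u where "u = d \<oplus> lam a (e \<oplus> lam b d')"
  define v where "v = a \<otimes> (b \<otimes> inv a)"
  have uv: "u \<in> carrier B" "v \<in> carrier B" using da eb d'c by (simp_all add: u_def v_def)
  have "twist d a c = \<ominus> g \<oplus> twist d a (twist e b f)"
    using da eb f by (simp add: c twist_add twist_minus g_def)
  also have "twist d a (twist e b f) = twist u v g"
    using da eb d'c gJ by (subst f_eq) (simp add: twist_comp u_def v_def del: lam_add)
  finally show ?thesis using twist_commutatorsI[OF gJ uv] by simp
qed

text \<open>
  For \<open>c = -f + \<phi>(f)\<close> with \<open>\<phi>\<close> a twist and \<open>m c\<close> in the annihilator, \<open>\<phi>\<close> fixes \<open>m c\<close>, so that
  \<open>(m+1) c = -f + m c + \<phi>(f) = -f + \<phi>(f) + \<phi>(m c)\<close>, and \<open>\<phi>(f) + \<phi>(c) = \<phi>\<^sup>2(f)\<close>. This gives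
  \<open>(m+1) c = (-f + \<phi>\<^sup>2(f)) + (m-1) \<phi>(c)\<close>, a sum of only \<open>m\<close> such elements.
\<close>

lemma twist_commutators_shortening:
  assumes c: "c \<in> twist_commutators"
  shows "\<exists>k ys. set ys \<subseteq> twist_commutators \<and> length ys < k \<and> [(k::nat)] \<cdot> c = add.list_prod ys"
proof -
  obtain f d a where f: "f \<in> J" and da: "d \<in> carrier B" "a \<in> carrier B"
    and c_eq: "c = \<ominus> f \<oplus> twist d a f" using c by (auto simp: twist_commutators_def)
  let ?t = "twist d a"
  have cJ: "c \<in> J" using c twist_commutators_subset by blast
  obtain m :: nat where m: "m > 0" "[m] \<cdot> c \<in> brace_Ann B" using multiple_in_Ann[OF cJ] by blast
  then obtain l where l: "m = Suc l" by (cases m) auto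
  have cc: "c \<in> carrier B" and fc: "f \<in> carrier B" using cJ f by auto
  have t_mult: "?t ([k] \<cdot> c) = [k] \<cdot> ?t c" for k :: nat
  proof (induction k)
    case 0
    then show ?case using da by (simp add: twist_def)
  next
    case (Suc k)
    then show ?case using da cc by (simp add: twist_add)
  qed
  have mc: "[m] \<cdot> c = [m] \<cdot> ?t c"
    using twist_Ann[OF m(2) da] t_mult by simp
  have f_c: "f \<oplus> c = ?t f" using fc da by (simp add: c_eq)
  have "[Suc m] \<cdot> c = [m] \<cdot> c \<oplus> c" using cc by simp
  also have "\<dots> = c \<oplus> [m] \<cdot> c" using brace_Ann_lam(3)[OF m(2) cc] by simp
  also have "\<dots> = \<ominus> f \<oplus> ?t f \<oplus> [m] \<cdot> ?t c" using mc by (simp add: c_eq)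
  also have "[m] \<cdot> ?t c = ?t c \<oplus> [l] \<cdot> ?t c"
    using add.nat_pow_Suc2[of "?t c" l] da cc by (simp add: l)
  also have "\<ominus> f \<oplus> ?t f \<oplus> (?t c \<oplus> [l] \<cdot> ?t c) = \<ominus> f \<oplus> ?t (f \<oplus> c) \<oplus> [l] \<cdot> ?t c"
    using da cc fc by (simp add: twist_add add.m_assoc)
  also have "?t (f \<oplus> c) = twist (d \<oplus> lam a d) (a \<otimes> a) f"
    using da fc by (simp add: f_c twist_comp)
  finally have eq: "[Suc m] \<cdot> c = add.list_prod ((\<ominus> f \<oplus> twist (d \<oplus> lam a d) (a \<otimes> a) f) # replicate l (?t c))"
    using add.list_prod_replicate[of "?t c" l] da cc by simp
  show ?thesis
  proof (intro exI conjI)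
    show "[Suc m] \<cdot> c = add.list_prod ((\<ominus> f \<oplus> twist (d \<oplus> lam a d) (a \<otimes> a) f) # replicate l (?t c))"
      by (rule eq)
    show "set ((\<ominus> f \<oplus> twist (d \<oplus> lam a d) (a \<otimes> a) f) # replicate l (?t c)) \<subseteq> twist_commutators"
      using twist_commutatorsI[OF f, of "d \<oplus> lam a d" "a \<otimes> a"] twist_twist_commutators[OF c da] da
      by (auto simp: set_replicate_conv_if)
  qed (simp add: l)
qed

lemma twist_commutators_carrier: "twist_commutators \<subseteq> carrier B"
  using twist_commutators_subset JD(1) by blast

lemma finite_generate_twist_commutators: "finite (generate (add_monoid B) twist_commutators)"
proof (rule add.finite_generate_of_shortening[OF twist_commutators_carrier finite_twist_commutators])
  fix x y assume "x \<in> twist_commutators" "y \<in> twist_commutators"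
  then show "\<ominus> x \<oplus> y \<oplus> x \<in> twist_commutators"
    using twist_twist_commutators[of y "\<ominus> x" \<zero>] twist_commutators_carrier
    by (auto simp: twist_conj subset_iff)
qed (rule twist_commutators_shortening)

text \<open>
  This is the conjugate \<open>-b + (f \<ast> b) + b\<close> of \<open>f \<ast> b\<close>. It has the advantage that
  \<open>b \<mapsto> displacement f b\<close> is constant on the right cosets of the fixed points of \<open>\<lambda>\<^sub>f\<close>.
\<close>

definition displacement :: "'a \<Rightarrow> 'a \<Rightarrow> 'a"
  where "displacement f b = \<ominus> b \<oplus> lam f b"

lemma displacement_closed [simp]:
  "f \<in> carrier B \<Longrightarrow> b \<in> carrier B \<Longrightarrow> displacement f b \<in> carrier B"
  by (simp add: displacement_def)

text \<open>
  Since \<open>J\<close> is normal in the circle group, \<open>f \<circ> b = b \<circ> g\<close> with \<open>g\<close> in \<open>J\<close>, which expresses \<open>\<lambda>\<^sub>f(b)\<close>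
  through \<open>\<lambda>\<^sub>b(g)\<close>.
\<close>

lemma displacement_in_J:
  assumes f: "f \<in> J" and b: "b \<in> carrier B"
  shows "displacement f b \<in> J"
proof -
  define g where "g = inv b \<otimes> f \<otimes> b"
  have gJ: "g \<in> J" using JD(8)[of "inv b" f] f b by (simp add: g_def)
  have "f \<oplus> lam f b = b \<oplus> lam b g"
    using f b circ_eq[of f b] circ_eq[of b g] by (simp add: g_def circ.m_assoc)
  then have "\<ominus> f \<oplus> (f \<oplus> lam f b) = \<ominus> f \<oplus> (b \<oplus> lam b g)" by simp
  then have "displacement f b = (\<ominus> b \<oplus> \<ominus> f \<oplus> \<ominus> (\<ominus> b)) \<oplus> lam b g"
    using f b gJ by (simp add: displacement_def add.m_assoc)
  then show ?thesis using JD(3)[OF JD(6)[of "\<ominus> b" "\<ominus> f"] JD(5)[OF b gJ]] JD(4)[OF f] b by simp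
qed

text \<open>
  The reason is the cocycle identity \<open>D(f \<circ> g, b) = D(f, b) + \<lambda>\<^sub>f(D(g, b))\<close> for \<open>D = displacement\<close>:
  as \<open>y = D(g, b)\<close> lies in \<open>J\<close>, replacing \<open>\<lambda>\<^sub>f(y)\<close> by \<open>y\<close> costs only the twist commutator
  \<open>-y + \<lambda>\<^sub>f(y)\<close>.
\<close>

lemma displacement_circ_power:
  assumes f: "f \<in> J" and b: "b \<in> carrier B"
  shows "\<exists>i \<in> generate (add_monoid B) twist_commutators.
    displacement (f [^] (k::nat)) b = [k] \<cdot> displacement f b \<oplus> i"
proof (induction k)
  case 0
  have "\<zero> \<in> generate (add_monoid B) twist_commutators"
    using generate.one[of "add_monoid B" twist_commutators] by simp
  then show ?case using b by (intro bexI[of _ \<zero>]) (simp add: displacement_def)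
next
  case (Suc k)
  let ?I = "generate (add_monoid B) twist_commutators"
  let ?D = "displacement f b"
  obtain i where i: "i \<in> ?I" "displacement (f [^] k) b = [k] \<cdot> ?D \<oplus> i" using Suc by blast
  have fc: "f \<in> carrier B" using f by simp
  have ic: "i \<in> carrier B"
    using i(1) group.generate_incl[OF add_group, of twist_commutators] twist_commutators_carrier by auto
  define y where "y = displacement (f [^] k) b"
  have "f [^] k \<in> J" using f by (induction k) (auto intro: JD)
  then have yJ: "y \<in> J" using displacement_in_J b by (simp add: y_def)
  define x where "x = \<ominus> y \<oplus> lam f y"
  have xI: "x \<in> ?I"
    using twist_commutatorsI[OF yJ, of \<zero> f] fc yJ by (auto simp: x_def twist_lam intro: generate.incl)
  have xc: "x \<in> carrier B" using fc yJ by (simp add: x_def)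
  have "lam (f [^] k) b = b \<oplus> y" using b fc by (simp add: y_def displacement_def)
  moreover have "f [^] Suc k = f \<otimes> f [^] k" using circ.nat_pow_Suc2[OF fc] .
  ultimately have "displacement (f [^] Suc k) b = \<ominus> b \<oplus> lam f (b \<oplus> y)"
    using fc b by (simp add: displacement_def)
  also have "\<dots> = ?D \<oplus> (y \<oplus> x)"
    using fc b yJ by (simp add: displacement_def x_def add.m_assoc)
  also have "\<dots> = (?D \<oplus> [k] \<cdot> ?D) \<oplus> (i \<oplus> x)"
    using fc b ic xc by (simp add: i(2)[folded y_def] add.m_assoc)
  also have "?D \<oplus> [k] \<cdot> ?D = [Suc k] \<cdot> ?D"
    using add.nat_pow_Suc2[of ?D k] fc b by simp
  finally show ?case using generate.eng[OF i(1) xI] by (intro bexI[of _ "i \<oplus> x"]) auto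
qed

text \<open>
  Some circle power of \<open>f\<close> lies in the annihilator and displaces nothing; hence a multiple of
  \<open>displacement f b\<close> lies in the finite group generated by the twist commutators.
\<close>

lemma displacement_torsion:
  assumes f: "f \<in> J" and b: "b \<in> carrier B"
  obtains k :: nat where "k > 0" "[k] \<cdot> displacement f b = \<zero>"
proof -
  let ?I = "generate (add_monoid B) twist_commutators"
  let ?D = "displacement f b"
  have I: "subgroup ?I (add_monoid B)"
    using group.generate_is_subgroup[OF add_group] twist_commutators_carrier by simp
  obtain k :: nat where k: "k > 0" "f [^] k \<in> brace_Ann B" using circ_power_in_Ann[OF f] by blast
  obtain i where i: "i \<in> ?I" "displacement (f [^] k) b = [k] \<cdot> ?D \<oplus> i"
    using displacement_circ_power[OF f b] by blast
  have ic: "i \<in> carrier B" using i(1) subgroup.mem_carrier[OF I] by auto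
  have "[k] \<cdot> ?D \<oplus> i = \<zero>"
    using i(2) brace_Ann_lam(1)[OF k(2) b] b by (simp add: displacement_def)
  then have "\<ominus> i = [k] \<cdot> ?D" using ic f b by (intro add.inv_equality) auto
  then have "[k] \<cdot> ?D \<in> ?I" using subgroup.m_inv_closed[OF I i(1)] by (simp add: a_inv_def)
  then obtain l :: nat where l: "l > 0" "[l] \<cdot> ([k] \<cdot> ?D) = \<zero>"
    using add.pow_eq_one_of_finite_subgroup[OF I finite_generate_twist_commutators] by blast
  have "[(k * l)] \<cdot> ?D = \<zero>" using l(2) f b by (simp add: add.nat_pow_pow)
  then show thesis using that[of "k * l"] k(1) l(1) by simp
qed

definition displacement_conjugates :: "'a set"
  where "displacement_conjugates =
    {d \<oplus> displacement f b \<oplus> \<ominus> d | f b d. f \<in> J \<and> b \<in> carrier B \<and> d \<in> carrier B}"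

lemma displacement_conjugatesI:
  "f \<in> J \<Longrightarrow> b \<in> carrier B \<Longrightarrow> d \<in> carrier B
    \<Longrightarrow> d \<oplus> displacement f b \<oplus> \<ominus> d \<in> displacement_conjugates"
  by (auto simp: displacement_conjugates_def)

lemma displacement_conjugates_subset: "displacement_conjugates \<subseteq> J"
  by (auto simp: displacement_conjugates_def intro!: JD(6) displacement_in_J)

text \<open>
  The identity \<open>d + D(f, b) - d = D(f, b - d) - D(f, -d)\<close> for \<open>D = displacement\<close> bounds the number
  of conjugates, and \<open>D(f, b)\<close> depends only on the coset of \<open>f\<close> modulo the annihilator.
\<close>

lemma finite_displacement_conjugates: "finite displacement_conjugates"
proof -
  obtain F where F: "finite F" "F \<subseteq> J"
    "\<And>x. x \<in> J \<Longrightarrow> \<exists>z\<in>brace_Ann B. \<exists>f\<in>F. x = z \<oplus> f" using representatives by blast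
  define V where "V f = displacement f ` carrier B" for f
  let ?S = "\<Union>f\<in>F. (\<lambda>(u, v). u \<oplus> \<ominus> v) ` (V f \<times> V f)"
  have "finite (V f)" if "f \<in> F" for f
    using orbits F(2) that J_carrier unfolding finite_orbits_def V_def displacement_def by blast
  then have "finite ?S" using F(1) by auto
  moreover have "displacement_conjugates \<subseteq> ?S"
  proof
    fix y assume "y \<in> displacement_conjugates"
    then obtain x b d where x: "x \<in> J" and bd: "b \<in> carrier B" "d \<in> carrier B"
      and y: "y = d \<oplus> displacement x b \<oplus> \<ominus> d" by (auto simp: displacement_conjugates_def)
    obtain z f where zf: "z \<in> brace_Ann B" "f \<in> F" "x = z \<oplus> f" using F(3)[OF x] by blast
    have zc: "z \<in> carrier B" and fc: "f \<in> carrier B" using zf AnnD(1) F(2) by auto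
    have "z \<oplus> f = z \<otimes> f" using zf(1) fc unfolding mem_brace_Ann_iff by metis
    then have "displacement x b = displacement f b"
      using zf(1) zc fc bd by (simp add: displacement_def zf(3) brace_Ann_lam)
    then have "y = displacement f (b \<oplus> \<ominus> d) \<oplus> \<ominus> displacement f (\<ominus> d)"
      using fc bd by (simp add: y displacement_def add.m_assoc add.inv_mult_group)
    then show "y \<in> ?S" using zf(2) bd unfolding V_def by force
  qed
  ultimately show ?thesis using finite_subset by blast
qed

lemma twist_displacement_conjugates:
  assumes y: "y \<in> displacement_conjugates" and da: "d \<in> carrier B" "a \<in> carrier B"
  shows "twist d a y \<in> displacement_conjugates"
proof -
  obtain f b e where f: "f \<in> J" and be: "b \<in> carrier B" "e \<in> carrier B"
    and y: "y = e \<oplus> displacement f b \<oplus> \<ominus> e" using y by (auto simp: displacement_conjugates_def)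
  define g where "g = a \<otimes> f \<otimes> inv a"
  have gJ: "g \<in> J" using JD(8) da f by (simp add: g_def)
  have "lam a (displacement f b) = displacement g (lam a b)"
    using da f be by (simp add: displacement_def g_def)
  then have "twist d a y = (d \<oplus> lam a e) \<oplus> displacement g (lam a b) \<oplus> \<ominus> (d \<oplus> lam a e)"
    using da f be gJ by (simp add: y twist_def add.m_assoc add.inv_mult_group)
  then show ?thesis using displacement_conjugatesI[OF gJ, of "lam a b" "d \<oplus> lam a e"] da be by simp
qed

lemma displacement_conjugates_torsion:
  assumes "y \<in> displacement_conjugates"
  obtains k :: nat where "k > 0" "[k] \<cdot> y = \<zero>"
proof -
  obtain f b d where f: "f \<in> J" and bd: "b \<in> carrier B" "d \<in> carrier B"
    and y: "y = d \<oplus> displacement f b \<oplus> \<ominus> d" using assms by (auto simp: displacement_conjugates_def)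
  obtain k :: nat where k: "k > 0" "[k] \<cdot> displacement f b = \<zero>"
    using displacement_torsion[OF f bd(1)] by blast
  have "[j] \<cdot> y = d \<oplus> [j] \<cdot> displacement f b \<oplus> \<ominus> d" for j :: nat
  proof (induction j)
    case (Suc j)
    then show ?case using f bd by (simp add: y add.m_assoc)
  qed (use bd in simp)
  then show thesis using that k bd by simp
qed

text \<open>
  This plays the part of the commutator of \<open>J\<close> and \<open>B\<close>: it is the normal subgroup of \<open>(B, +)\<close>
  generated by the additive commutators of \<open>J\<close> with \<open>B\<close> and the elements \<open>b \<ast> f\<close>, \<open>f \<ast> b\<close> with \<open>f\<close> in \<open>J\<close>.
\<close>

definition commutator_ideal :: "'a set"
  where "commutator_ideal =
    generate (add_monoid B) (twist_commutators \<union> displacement_conjugates)"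

lemma generators_carrier: "twist_commutators \<union> displacement_conjugates \<subseteq> carrier B"
  using twist_commutators_subset displacement_conjugates_subset JD(1) by blast

lemma commutator_ideal_subgroup: "subgroup commutator_ideal (add_monoid B)"
  using group.generate_is_subgroup[OF add_group] generators_carrier
  by (simp add: commutator_ideal_def)

lemma twist_generators:
  assumes "x \<in> twist_commutators \<union> displacement_conjugates" "d \<in> carrier B" "a \<in> carrier B"
  shows "twist d a x \<in> twist_commutators \<union> displacement_conjugates"
  using assms twist_twist_commutators twist_displacement_conjugates by blast

text \<open>
  The two kinds of generators satisfy the shortening condition for different reasons, one as in
  Schur's theorem and the other by having finite order.
\<close>

lemma finite_commutator_ideal: "finite commutator_ideal"
  unfolding commutator_ideal_def
proof (rule add.finite_generate_of_shortening[OF generators_carrier])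
  let ?X = "twist_commutators \<union> displacement_conjugates"
  show "finite ?X" using finite_twist_commutators finite_displacement_conjugates by simp
  show "\<ominus> x \<oplus> y \<oplus> x \<in> ?X" if "x \<in> ?X" "y \<in> ?X" for x y
  proof -
    have "x \<in> carrier B" "y \<in> carrier B" using that generators_carrier by blast+
    then show ?thesis using twist_generators[OF that(2), of "\<ominus> x" \<zero>] by (simp add: twist_conj)
  qed
  show "\<exists>k ys. set ys \<subseteq> ?X \<and> length ys < k \<and> [(k::nat)] \<cdot> x = add.list_prod ys" if "x \<in> ?X" for x
  proof (cases "x \<in> twist_commutators")
    case True
    from twist_commutators_shortening[OF True] obtain k :: nat and ys where
      ys: "set ys \<subseteq> twist_commutators" "length ys < k" "[k] \<cdot> x = add.list_prod ys"
      by (elim exE conjE)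
    show ?thesis by (rule exI[of _ k], rule exI[of _ ys]) (intro conjI ys le_supI1)
  next
    case False
    then have "x \<in> displacement_conjugates" using that by blast
    then obtain k :: nat where "k > 0" "[k] \<cdot> x = \<zero>"
      by (rule displacement_conjugates_torsion)
    then show ?thesis by (intro exI[of _ k] exI[of _ "[]"]) simp
  qed
qed

lemma commutator_ideal_subset: "commutator_ideal \<subseteq> J"
  unfolding commutator_ideal_def
  using group.generate_subgroup_incl[OF add_group _ JD(10)]
    twist_commutators_subset displacement_conjugates_subset by blast

lemma twist_commutator_mem:
  assumes "f \<in> J" "d \<in> carrier B" "a \<in> carrier B"
  shows "\<ominus> f \<oplus> twist d a f \<in> commutator_ideal"
  using twist_commutatorsI[OF assms] by (auto simp: commutator_ideal_def intro: generate.incl)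

lemma displacement_mem:
  assumes "f \<in> J" "b \<in> carrier B" "d \<in> carrier B"
  shows "d \<oplus> displacement f b \<oplus> \<ominus> d \<in> commutator_ideal"
  using displacement_conjugatesI[OF assms] by (auto simp: commutator_ideal_def intro: generate.incl)

lemma commutator_ideal_ideal: "brace_ideal commutator_ideal B"
proof (rule brace_idealI)
  show sub: "commutator_ideal \<subseteq> carrier B" using commutator_ideal_subset JD(1) by blast
  show "\<zero> \<in> commutator_ideal" using subgroup.one_closed[OF commutator_ideal_subgroup] by simp
  show add: "x \<oplus> y \<in> commutator_ideal" if "x \<in> commutator_ideal" "y \<in> commutator_ideal" for x y
    using subgroup.m_closed[OF commutator_ideal_subgroup that] by simp
  show minus: "\<ominus> x \<in> commutator_ideal" if "x \<in> commutator_ideal" for x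
    using subgroup.m_inv_closed[OF commutator_ideal_subgroup that] by (simp add: a_inv_def)
  show twist: "twist d a x \<in> commutator_ideal"
    if da: "d \<in> carrier B" "a \<in> carrier B" and x: "x \<in> commutator_ideal" for d a x
  proof -
    let ?X = "twist_commutators \<union> displacement_conjugates"
    have "twist d a ` ?X \<subseteq> commutator_ideal"
      using twist_generators[OF _ da] by (auto simp: commutator_ideal_def intro!: generate.incl)
    then have "twist d a ` generate (add_monoid B) ?X \<subseteq> commutator_ideal"
      using group.hom_generate_subset[OF add_group _ twist_hom[OF da] commutator_ideal_subgroup]
        generators_carrier by simp
    then show ?thesis using x by (auto simp: commutator_ideal_def)
  qed
  show "a \<otimes> x \<otimes> inv a \<in> commutator_ideal" if a: "a \<in> carrier B" and x: "x \<in> commutator_ideal" for a x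
  proof -
    have xJ: "x \<in> J" using x commutator_ideal_subset by blast
    define g where "g = a \<otimes> x \<otimes> inv a"
    have gJ: "g \<in> J" using JD(8) a xJ by (simp add: g_def)
    \<comment> \<open>Rewriting \<open>a \<circ> x = g \<circ> a\<close> gives \<open>g = a + \<lambda>\<^sub>a(x) - \<lambda>\<^sub>g(a)\<close>, and
      \<open>\<lambda>\<^sub>g(a) = a + displacement g a\<close>.\<close>
    have "g \<oplus> lam g a = a \<oplus> lam a x"
      using a xJ gJ circ_eq[of g a] circ_eq[of a x] by (simp add: g_def circ.m_assoc)
    then have "g \<oplus> lam g a \<oplus> \<ominus> lam g a = a \<oplus> lam a x \<oplus> \<ominus> lam g a" by simp
    then have "g = twist a a x \<oplus> (a \<oplus> \<ominus> displacement g a \<oplus> \<ominus> a)"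
      using a xJ gJ by (simp add: twist_def displacement_def add.m_assoc add.inv_mult_group)
    moreover have "a \<oplus> \<ominus> displacement g a \<oplus> \<ominus> a = \<ominus> (a \<oplus> displacement g a \<oplus> \<ominus> a)"
      using a gJ by (simp add: add.m_assoc add.inv_mult_group)
    ultimately have "g \<in> commutator_ideal"
      using add[OF twist[OF a a x] minus[OF displacement_mem[OF gJ a a]]] by simp
    then show ?thesis by (simp add: g_def)
  qed
qed

lemma central_mod_commutator_ideal:
  assumes x: "x \<in> J"
  shows "central_mod B commutator_ideal x"
  unfolding central_mod_def
proof (intro ballI)
  let ?I = commutator_ideal
  fix b assume b: "b \<in> carrier B"
  have xc: "x \<in> carrier B" using x by simp
  note D = brace_idealD[OF commutator_ideal_ideal]
  have eq: "?I +> u = ?I +> v" if "\<ominus> v \<oplus> u \<in> ?I" "u \<in> carrier B" "v \<in> carrier B" for u v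
    using D(6)[OF that(3,1)] that(2,3) a_rcos_eq_iff[OF D(10) that(2,3)] by (simp add: add.m_assoc)
  have "\<ominus> x \<oplus> twist (\<ominus> b) \<zero> x \<in> ?I" using twist_commutator_mem x b by simp
  then have "\<ominus> (b \<oplus> x) \<oplus> (x \<oplus> b) \<in> ?I"
    using xc b by (simp add: twist_conj add.inv_mult_group add.m_assoc)
  then have 1: "?I +> (x \<oplus> b) = ?I +> (b \<oplus> x)" using eq xc b by simp
  have "\<ominus> b \<oplus> lam x b \<in> ?I"
    using displacement_mem[OF x b, of \<zero>] xc b by (simp add: displacement_def)
  then have "\<ominus> (x \<oplus> b) \<oplus> (x \<otimes> b) \<in> ?I"
    using xc b by (simp add: circ_eq add.inv_mult_group add.m_assoc)
  then have 2: "?I +> (x \<otimes> b) = ?I +> (x \<oplus> b)" using eq xc b by simp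
  have "\<ominus> x \<oplus> lam b x \<in> ?I"
    using twist_commutator_mem[OF x, of \<zero> b] xc b by (simp add: twist_lam)
  then have "\<ominus> (b \<oplus> x) \<oplus> (b \<otimes> x) \<in> ?I"
    using xc b by (simp add: circ_eq add.inv_mult_group add.m_assoc)
  then have 3: "?I +> (b \<otimes> x) = ?I +> (b \<oplus> x)" using eq xc b by simp
  show "?I +> (x \<oplus> b) = ?I +> (b \<oplus> x) \<and> ?I +> (x \<otimes> b) = ?I +> (x \<oplus> b) \<and>
    ?I +> (b \<otimes> x) = ?I +> (x \<oplus> b)" using 1 2 3 by simp
qed

end


section \<open>Quotients and the annihilator series\<close>

text \<open>
  Surjective homomorphisms, through which the quotient map is used without reference to cosets.
\<close>

locale skew_brace_epi = B: skew_brace B + C: skew_brace C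
  for B (structure) and C (structure) +
  fixes h
  assumes image: "h ` carrier B = carrier C"
    and h_add [simp]: "x \<in> carrier B \<Longrightarrow> y \<in> carrier B \<Longrightarrow> h (x \<oplus> y) = h x \<oplus>\<^bsub>C\<^esub> h y"
    and h_circ [simp]: "x \<in> carrier B \<Longrightarrow> y \<in> carrier B \<Longrightarrow> h (x \<otimes> y) = h x \<otimes>\<^bsub>C\<^esub> h y"
begin

lemma h_closed [simp]: "x \<in> carrier B \<Longrightarrow> h x \<in> carrier C"
  using image by blast

lemma h_surj: "y \<in> carrier C \<Longrightarrow> \<exists>x\<in>carrier B. y = h x"
  using image by blast

lemma h_zero [simp]: "h \<zero> = \<zero>\<^bsub>C\<^esub>"
proof -
  have "h \<zero> \<oplus>\<^bsub>C\<^esub> h \<zero> = h \<zero>" using h_add[of \<zero> \<zero>] by (simp del: h_add)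
  then show ?thesis by simp
qed

lemma h_minus [simp]: "x \<in> carrier B \<Longrightarrow> h (\<ominus> x) = \<ominus>\<^bsub>C\<^esub> h x"
  by (rule C.add.inv_equality[symmetric]) (simp_all flip: h_add)

lemma h_inv [simp]: "x \<in> carrier B \<Longrightarrow> h (inv x) = inv\<^bsub>C\<^esub> h x"
  by (rule C.circ.inv_equality[symmetric]) (simp_all flip: h_circ)

lemma h_lam [simp]:
  "x \<in> carrier B \<Longrightarrow> y \<in> carrier B \<Longrightarrow> h (B.lam x y) = C.lam (h x) (h y)"
  by (simp add: brace_lambda_def)

lemma h_twist [simp]:
  "d \<in> carrier B \<Longrightarrow> a \<in> carrier B \<Longrightarrow> x \<in> carrier B \<Longrightarrow> h (B.twist d a x) = C.twist (h d) (h a) (h x)"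
  by (simp add: B.twist_def C.twist_def)

lemma preimage_ideal:
  assumes K: "brace_ideal K C"
  shows "brace_ideal {x \<in> carrier B. h x \<in> K} B"
  using C.brace_idealD[OF K] by (intro B.brace_idealI) auto

lemma image_ideal:
  assumes J: "brace_ideal J B"
  shows "brace_ideal (h ` J) C"
proof (rule C.brace_idealI)
  note D = B.brace_idealD[OF J]
  have c: "x \<in> carrier B" if "x \<in> J" for x using that D(1) by blast
  show "h ` J \<subseteq> carrier C" using c by auto
  show "\<zero>\<^bsub>C\<^esub> \<in> h ` J" using D(2) h_zero by (metis imageI)
  show "x \<oplus>\<^bsub>C\<^esub> y \<in> h ` J" if "x \<in> h ` J" "y \<in> h ` J" for x y
    using that D(3) c by (auto simp flip: h_add)
  show "\<ominus>\<^bsub>C\<^esub> x \<in> h ` J" if "x \<in> h ` J" for x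
    using that D(4) c by (auto simp flip: h_minus)
  show "C.twist d a x \<in> h ` J" if "d \<in> carrier C" "a \<in> carrier C" "x \<in> h ` J" for d a x
  proof -
    from h_surj[OF that(1)] h_surj[OF that(2)] that(3)
    obtain d' a' x' where "d' \<in> carrier B" "a' \<in> carrier B" "x' \<in> J" "d = h d'" "a = h a'" "x = h x'"
      by (elim bexE imageE)
    then show ?thesis using D(7)[of d' a' x'] c by (auto simp flip: h_twist)
  qed
  show "a \<otimes>\<^bsub>C\<^esub> x \<otimes>\<^bsub>C\<^esub> inv\<^bsub>C\<^esub> a \<in> h ` J" if "a \<in> carrier C" "x \<in> h ` J" for a x
  proof -
    from h_surj[OF that(1)] that(2)
    obtain a' x' where "a' \<in> carrier B" "x' \<in> J" "a = h a'" "x = h x'"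
      by (elim bexE imageE)
    then show ?thesis using D(8)[of a' x'] c by (auto simp flip: h_circ h_inv)
  qed
qed

lemma finite_orbits_image:
  assumes fin: "finite_orbits B"
  shows "finite_orbits C"
  unfolding finite_orbits_def
proof
  fix y assume "y \<in> carrier C"
  then obtain x where x: "x \<in> carrier B" "y = h x" using h_surj by blast
  have "(\<lambda>d. d \<oplus>\<^bsub>C\<^esub> y \<oplus>\<^bsub>C\<^esub> \<ominus>\<^bsub>C\<^esub> d) ` carrier C = h ` (\<lambda>d. d \<oplus> x \<oplus> \<ominus> d) ` carrier B"
    "(\<lambda>a. C.lam a y) ` carrier C = h ` (\<lambda>a. B.lam a x) ` carrier B"
    "(\<lambda>b. \<ominus>\<^bsub>C\<^esub> b \<oplus>\<^bsub>C\<^esub> C.lam y b) ` carrier C = h ` (\<lambda>b. \<ominus> b \<oplus> B.lam x b) ` carrier B"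
    using x unfolding image[symmetric] image_image by (auto intro!: image_cong)
  then show "finite ((\<lambda>d. d \<oplus>\<^bsub>C\<^esub> y \<oplus>\<^bsub>C\<^esub> \<ominus>\<^bsub>C\<^esub> d) ` carrier C) \<and>
      finite ((\<lambda>a. C.lam a y) ` carrier C) \<and>
      finite ((\<lambda>b. \<ominus>\<^bsub>C\<^esub> b \<oplus>\<^bsub>C\<^esub> C.lam y b) ` carrier C)"
    using fin x(1) by (simp add: finite_orbits_def)
qed

text \<open>
  Congruence modulo \<open>W\<close> is mapped to congruence modulo \<open>V\<close>, and every element of \<open>C\<close> is an image.
\<close>

lemma central_mod_image:
  assumes W: "brace_ideal W B" and V: "brace_ideal V C" and WV: "h ` W \<subseteq> V"
    and x: "x \<in> carrier B" "central_mod B W x"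
  shows "central_mod C V (h x)"
  unfolding central_mod_def
proof
  have eq: "V +>\<^bsub>C\<^esub> h u = V +>\<^bsub>C\<^esub> h v"
    if "W +> u = W +> v" "u \<in> carrier B" "v \<in> carrier B" for u v
  proof -
    have "u \<oplus> \<ominus> v \<in> W" using B.a_rcos_eq_iff[OF B.brace_idealD(10)[OF W]] that by blast
    then have "h (u \<oplus> \<ominus> v) \<in> V" using WV by blast
    then show ?thesis using C.a_rcos_eq_iff[OF C.brace_idealD(10)[OF V]] that by simp
  qed
  fix y assume "y \<in> carrier C"
  then obtain b where b: "b \<in> carrier B" "y = h b" using h_surj by blast
  have "W +> (x \<oplus> b) = W +> (b \<oplus> x)" "W +> (x \<otimes> b) = W +> (x \<oplus> b)" "W +> (b \<otimes> x) = W +> (x \<oplus> b)"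
    using x(2) b(1) unfolding central_mod_def by blast+
  from this[THEN eq] show "V +>\<^bsub>C\<^esub> (h x \<oplus>\<^bsub>C\<^esub> y) = V +>\<^bsub>C\<^esub> (y \<oplus>\<^bsub>C\<^esub> h x) \<and>
      V +>\<^bsub>C\<^esub> (h x \<otimes>\<^bsub>C\<^esub> y) = V +>\<^bsub>C\<^esub> (h x \<oplus>\<^bsub>C\<^esub> y) \<and>
      V +>\<^bsub>C\<^esub> (y \<otimes>\<^bsub>C\<^esub> h x) = V +>\<^bsub>C\<^esub> (h x \<oplus>\<^bsub>C\<^esub> y)"
    using x(1) b by simp
qed

lemma central_mod_preimage:
  assumes V: "brace_ideal V C" and x: "x \<in> carrier B" "central_mod C V (h x)"
  shows "central_mod B {y \<in> carrier B. h y \<in> V} x"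
  unfolding central_mod_def
proof
  let ?W = "{y \<in> carrier B. h y \<in> V}"
  have eq: "?W +> u = ?W +> v"
    if "V +>\<^bsub>C\<^esub> h u = V +>\<^bsub>C\<^esub> h v" "u \<in> carrier B" "v \<in> carrier B" for u v
  proof -
    have "h u \<oplus>\<^bsub>C\<^esub> \<ominus>\<^bsub>C\<^esub> h v \<in> V"
      using C.a_rcos_eq_iff[OF C.brace_idealD(10)[OF V]] that h_closed by blast
    then have "u \<oplus> \<ominus> v \<in> ?W" using that by simp
    then show ?thesis
      using B.a_rcos_eq_iff[OF B.brace_idealD(10)[OF preimage_ideal[OF V]]] that by blast
  qed
  fix b assume b: "b \<in> carrier B"
  then have "V +>\<^bsub>C\<^esub> h (x \<oplus> b) = V +>\<^bsub>C\<^esub> h (b \<oplus> x)" "V +>\<^bsub>C\<^esub> h (x \<otimes> b) = V +>\<^bsub>C\<^esub> h (x \<oplus> b)"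
    "V +>\<^bsub>C\<^esub> h (b \<otimes> x) = V +>\<^bsub>C\<^esub> h (x \<oplus> b)"
    using x unfolding central_mod_def by simp_all
  from this[THEN eq] show "?W +> (x \<oplus> b) = ?W +> (b \<oplus> x) \<and>
      ?W +> (x \<otimes> b) = ?W +> (x \<oplus> b) \<and> ?W +> (b \<otimes> x) = ?W +> (x \<oplus> b)"
    using x(1) b by simp
qed

end

lemma group_cong:
  assumes "group G" "carrier H = carrier G" "mult H = mult G" "one H = one G"
  shows "group H"
proof -
  interpret group G by fact
  show ?thesis
    by (rule groupI) (auto simp: assms(2-) m_assoc intro: l_inv_ex)
qed

context skew_brace
begin

text \<open>
  The two groups of \<open>B/I\<close> are the factor groups of the two groups of \<open>B\<close>; the brace identity is
  inherited because \<open>x \<mapsto> I + x\<close> is onto and respects both operations.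
\<close>

lemma brace_quot_epi:
  assumes I: "brace_ideal I B"
  shows "skew_brace_epi B (brace_quot B I) (\<lambda>x. I +> x)"
proof -
  let ?C = "brace_quot B I"
  note D = brace_idealD[OF I]
  interpret NA: normal I "add_monoid B" by (rule D)
  interpret NM: normal I B by (rule D)
  have carr: "carrier ?C = (\<lambda>x. I +> x) ` carrier B"
    by (auto simp: brace_quot_def A_RCOSETS_def RCOSETS_def a_r_coset_def)
  have carr': "carrier ?C = (\<lambda>x. I #> x) ` carrier B"
    unfolding carr using brace_ideal_cosets[OF I] by simp
  have A: "group (add_monoid ?C)"
    by (rule group_cong[OF NA.factorgroup_is_group])
      (simp_all add: carr carrier_FactGroup a_r_coset_def, simp_all add: brace_quot_def set_add_def)
  have M: "group ?C"
    by (rule group_cong[OF NM.factorgroup_is_group], unfold carr' carrier_FactGroup)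
      (auto simp: brace_quot_def)
  have add: "I +> (x \<oplus> y) = (I +> x) \<oplus>\<^bsub>?C\<^esub> (I +> y)" if "x \<in> carrier B" "y \<in> carrier B" for x y
    using NA.rcos_sum[of x y] that by (simp add: brace_quot_def set_add_def a_r_coset_def)
  have circ: "I +> (x \<otimes> y) = (I +> x) \<otimes>\<^bsub>?C\<^esub> (I +> y)" if "x \<in> carrier B" "y \<in> carrier B" for x y
    using NM.rcos_sum[of x y] that brace_ideal_cosets[OF I] by (simp add: brace_quot_def)
  have minus: "I +> (\<ominus> x) = \<ominus>\<^bsub>?C\<^esub> (I +> x)" if x: "x \<in> carrier B" for x
  proof -
    interpret AC: group "add_monoid ?C" by (rule A)
    have "(I +> \<ominus> x) \<oplus>\<^bsub>?C\<^esub> (I +> x) = \<zero>\<^bsub>?C\<^esub>"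
      using add[of "\<ominus> x" x] x add.coset_mult_one[of I] D(1) by (simp add: brace_quot_def)
    then show ?thesis using AC.inv_equality[of "I +> \<ominus> x" "I +> x"] x
      by (simp add: a_inv_def[of ?C] carr)
  qed
  have "skew_brace ?C"
  proof (rule skew_brace.intro[OF A M])
    fix a b c assume "a \<in> carrier ?C" "b \<in> carrier ?C" "c \<in> carrier ?C"
    then obtain x y z where xyz: "x \<in> carrier B" "y \<in> carrier B" "z \<in> carrier B"
      and abc: "a = I +> x" "b = I +> y" "c = I +> z" unfolding carr by blast
    have "I +> (x \<otimes> (y \<oplus> z)) = I +> (x \<otimes> y \<oplus> \<ominus> x \<oplus> x \<otimes> z)"
      using brace_eq[OF xyz] by (simp add: a_minus_def)
    then show "a \<otimes>\<^bsub>?C\<^esub> (b \<oplus>\<^bsub>?C\<^esub> c) = a \<otimes>\<^bsub>?C\<^esub> b \<ominus>\<^bsub>?C\<^esub> a \<oplus>\<^bsub>?C\<^esub> a \<otimes>\<^bsub>?C\<^esub> c"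
      using xyz by (simp add: abc add circ minus a_minus_def)
  qed
  then show ?thesis
    using add circ carr
    by (intro skew_brace_epi.intro skew_brace_epi_axioms.intro skew_brace_axioms) auto
qed

lemma brace_Ann_quot_iff:
  assumes I: "brace_ideal I B" and x: "x \<in> carrier B"
  shows "I +> x \<in> brace_Ann (brace_quot B I) \<longleftrightarrow> central_mod B I x"
proof -
  interpret q: skew_brace_epi B "brace_quot B I" "\<lambda>x. I +> x" by (rule brace_quot_epi[OF I])
  show ?thesis
    unfolding q.C.mem_brace_Ann_iff central_mod_def q.image[symmetric] using x by auto
qed

lemma brace_ideal_carrier: "brace_ideal (carrier B) B"
  by (rule brace_idealI) auto

lemma brace_ideal_Ann_series: "brace_ideal (brace_Ann_series B k) B"
proof (induction k)
  case 0
  show ?case by (rule brace_idealI) (auto simp: twist_def)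
next
  case (Suc k)
  interpret q: skew_brace_epi B "brace_quot B (brace_Ann_series B k)" "\<lambda>x. brace_Ann_series B k +> x"
    by (rule brace_quot_epi[OF Suc])
  show ?case using q.preimage_ideal[OF q.C.brace_ideal_Ann] by simp
qed

lemma mem_Ann_series_Suc_iff:
  "x \<in> brace_Ann_series B (Suc k) \<longleftrightarrow> x \<in> carrier B \<and> central_mod B (brace_Ann_series B k) x"
  using brace_Ann_quot_iff[OF brace_ideal_Ann_series] by auto

end


section \<open>Descending along the annihilator series\<close>

text \<open>
  There are ideals \<open>J = K\<^sub>0, K\<^sub>1, \<dots>, K\<^sub>k = B\<close> with each \<open>K\<^sub>i\<^sub>+\<^sub>1\<close> central modulo \<open>K\<^sub>i\<close>. The recursion
  prepends a term at the bottom because the proof starts from \<open>B\<close> and works downwards.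
\<close>

primrec central_chain :: "('a, 'm) ring_scheme \<Rightarrow> nat \<Rightarrow> 'a set \<Rightarrow> bool"
  where
    "central_chain B 0 J \<longleftrightarrow> J = carrier B"
  | "central_chain B (Suc k) J \<longleftrightarrow> brace_ideal J B \<and>
      (\<exists>K. central_chain B k K \<and> (\<forall>x\<in>K. central_mod B J x))"

context skew_brace
begin

lemma central_chain_ideal: "central_chain B k J \<Longrightarrow> brace_ideal J B"
  using brace_ideal_carrier by (cases k) auto

text \<open>
  The annihilator series is the fastest ascending central series, so it overtakes the chain: if \<open>J\<close>
  lies below its term \<open>i\<close>, then the ideal above \<open>J\<close> lies below its term \<open>i + 1\<close>.
\<close>

lemma central_chain_Ann_series:
  assumes I: "brace_ideal I B" and "central_chain B k J"
    and "(\<lambda>x. I +> x) ` J \<subseteq> brace_Ann_series (brace_quot B I) i"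
  shows "brace_Ann_series (brace_quot B I) (k + i) = carrier (brace_quot B I)"
  using assms(2,3)
proof (induction k arbitrary: J i)
  case 0
  interpret q: skew_brace_epi B "brace_quot B I" "\<lambda>x. I +> x" by (rule brace_quot_epi[OF I])
  show ?case using 0 q.image q.C.brace_idealD(1)[OF q.C.brace_ideal_Ann_series, of i] by auto
next
  case (Suc k)
  interpret q: skew_brace_epi B "brace_quot B I" "\<lambda>x. I +> x" by (rule brace_quot_epi[OF I])
  from Suc.prems(1) obtain K where J: "brace_ideal J B" and K: "central_chain B k K"
    "\<And>x. x \<in> K \<Longrightarrow> central_mod B J x" by auto
  have "(\<lambda>x. I +> x) ` K \<subseteq> brace_Ann_series (brace_quot B I) (Suc i)"
  proof
    fix y assume "y \<in> (\<lambda>x. I +> x) ` K"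
    then obtain x where x: "x \<in> K" "y = I +> x" by blast
    have xc: "x \<in> carrier B" using brace_idealD(1)[OF central_chain_ideal[OF K(1)]] x(1) by blast
    show "y \<in> brace_Ann_series (brace_quot B I) (Suc i)"
      unfolding q.C.mem_Ann_series_Suc_iff x(2)
      using q.h_closed[OF xc]
        q.central_mod_image[OF J q.C.brace_ideal_Ann_series Suc.prems(2) xc K(2)[OF x(1)]] by blast
  qed
  from Suc.IH[OF K(1) this] show ?case by simp
qed

lemma annihilator_nilpotent_of_central_chain:
  assumes "central_chain B n I"
  shows "annihilator_nilpotent (brace_quot B I) n"
proof -
  have I: "brace_ideal I B" by (rule central_chain_ideal[OF assms])
  have "I +> x = I" if "x \<in> I" for x
    using add.coset_join2[OF _ brace_idealD(10)[OF I] that] brace_idealD(1)[OF I] that by blast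
  then have "(\<lambda>x. I +> x) ` I \<subseteq> brace_Ann_series (brace_quot B I) 0"
    by (auto simp: brace_quot_def)
  from central_chain_Ann_series[OF I assms this] show ?thesis
    by (simp add: annihilator_nilpotent_def)
qed

text \<open>
  The image of \<open>J\<close> in \<open>C = B/Ann\<^sub>m(B)\<close> is finite modulo \<open>Ann(C) = Ann\<^sub>m\<^sub>+\<^sub>1(B)/Ann\<^sub>m(B)\<close>, so it has a finite
  commutator ideal in \<open>C\<close>; its preimage is the next term of the chain.
\<close>

lemma central_chain_step:
  assumes orbits: "finite_orbits B"
    and J: "central_chain B k J" and fin: "finite ((\<lambda>x. brace_Ann_series B (Suc m) +> x) ` J)"
  shows "\<exists>I. central_chain B (Suc k) I \<and> finite ((\<lambda>x. brace_Ann_series B m +> x) ` I)"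
proof -
  let ?W = "brace_Ann_series B m"
  let ?Z = "brace_Ann_series B (Suc m)"
  let ?C = "brace_quot B ?W"
  let ?q = "\<lambda>x. ?W +> x"
  note W = brace_ideal_Ann_series[of m] and Z = brace_ideal_Ann_series[of "Suc m"]
  interpret q: skew_brace_epi B ?C ?q by (rule brace_quot_epi[OF W])
  have J': "brace_ideal J B" by (rule central_chain_ideal[OF J])
  have Jc: "x \<in> carrier B" if "x \<in> J" for x using that brace_idealD(1)[OF J'] by blast
  have "finite ((\<lambda>x. brace_Ann ?C +>\<^bsub>?C\<^esub> ?q x) ` J)"
  proof (rule finite_image_of_factor[OF fin])
    fix x y assume xy: "x \<in> J" "y \<in> J" "?Z +> x = ?Z +> y"
    then have "x \<oplus> \<ominus> y \<in> ?Z" using a_rcos_eq_iff[OF brace_idealD(10)[OF Z]] Jc by blast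
    then have "?q (x \<oplus> \<ominus> y) \<in> brace_Ann ?C" by simp
    then show "brace_Ann ?C +>\<^bsub>?C\<^esub> ?q x = brace_Ann ?C +>\<^bsub>?C\<^esub> ?q y"
      using q.C.a_rcos_eq_iff[OF q.C.brace_idealD(10)[OF q.C.brace_ideal_Ann]] Jc xy by simp
  qed
  then interpret C: ideal_finite_mod_Ann ?C "?q ` J"
    using q.image_ideal[OF J'] q.finite_orbits_image[OF orbits]
    by unfold_locales (simp_all add: image_image)
  define I where "I = {x \<in> carrier B. ?q x \<in> C.commutator_ideal}"
  have I: "brace_ideal I B"
    unfolding I_def by (rule q.preimage_ideal[OF C.commutator_ideal_ideal])
  have "central_mod B I x" if "x \<in> J" for x
    unfolding I_def
    using q.central_mod_preimage[OF C.commutator_ideal_ideal Jc[OF that]]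
      C.central_mod_commutator_ideal that by blast
  then have "central_chain B (Suc k) I" using I J by auto
  moreover have "finite (?q ` I)"
    by (rule finite_subset[OF _ C.finite_commutator_ideal]) (auto simp: I_def)
  ultimately show ?thesis by blast
qed

end

theorem theorem3p37:
  fixes B :: "('a, 'm) ring_scheme" and n :: nat
  assumes "skew_brace B"
    and "property_S B"
    and "n > 0"
    and "finite (carrier (brace_quot B (brace_Ann_series B n)))"
  shows "\<exists>I. brace_ideal I B \<and> finite I \<and> annihilator_nilpotent (brace_quot B I) n"
proof -
  interpret skew_brace B by fact
  \<comment> \<open>For \<open>k = 0\<close> take \<open>J = B\<close>; each step trades one term of the annihilator series for one
    link of the chain. For \<open>k = n\<close> finiteness is modulo \<open>Ann\<^sub>0(B) = {0}\<close>, that is, absolute.\<close>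
  have "\<exists>J. central_chain B k J \<and> finite ((\<lambda>x. brace_Ann_series B (n - k) +>\<^bsub>B\<^esub> x) ` J)"
    if "k \<le> n" for k
    using that
  proof (induction k)
    case 0
    interpret q: skew_brace_epi B "brace_quot B (brace_Ann_series B n)"
      "\<lambda>x. brace_Ann_series B n +>\<^bsub>B\<^esub> x" by (rule brace_quot_epi[OF brace_ideal_Ann_series])
    show ?case using assms(4) q.image by simp
  next
    case (Suc k)
    then have "n - k = Suc (n - Suc k)" by simp
    then show ?case
      using Suc central_chain_step[OF finite_orbits_of_property_S[OF assms(2)]] by (metis Suc_leD)
  qed
  from this[of n] obtain I where I: "central_chain B n I"
    and fin: "finite ((\<lambda>x. {\<zero>\<^bsub>B\<^esub>} +>\<^bsub>B\<^esub> x) ` I)" by auto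
  have ideal: "brace_ideal I B" by (rule central_chain_ideal[OF I])
  have "{\<zero>\<^bsub>B\<^esub>} +>\<^bsub>B\<^esub> x = {x}" if "x \<in> I" for x
    using brace_idealD(1)[OF ideal] that by (auto simp: a_r_coset_def r_coset_def)
  then have "inj_on (\<lambda>x. {\<zero>\<^bsub>B\<^esub>} +>\<^bsub>B\<^esub> x) I" by (auto simp: inj_on_def)
  then have "finite I" using fin finite_imageD by blast
  then show ?thesis using ideal annihilator_nilpotent_of_central_chain[OF I] by blast
qed

end
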